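(* Let $k\ge1$ and let $(X,\mathbb{Z}^k,T)$ be a continuum-wise expansive $\mathbb{Z}^k$-action. Then there is a finite constant $C\ge0$, depending only on $(X,\mathbb{Z}^k,T)$, such that $\mathrm{mdim}(X,T,\langle\vec v\rangle^{\perp})\le C$ for every nonzero $\vec v\in\mathbb{R}^k$. In particular, all $(k-1)$-dimensional directional mean dimensions of $(X,\mathbb{Z}^k,T)$ are finite.
   Context: A $\mathbb{Z}^k$-action $(X,\mathbb{Z}^k,T)$ is a compact metric space $X$ together with a continuous map $T\colon\mathbb{Z}^k\times X\to X$, $(n,x)\mapsto T^nx$, with $T^0x=x$ and $T^{m+n}x=T^m(T^nx)$. $C(X)$ denotes the set of nonempty connected closed subsets of $X$, and a set is nondegenerate if it has at least two points. The action is continuum-wise expansive if there is $c>0$ such that for every nondegenerate $A\in C(X)$ there exists $n\in\mathbb{Z}^k$ with $\mathrm{diam}\,T^n(A)>c$. For a compact metric space $(X,d)$ and $\epsilon>0$, an $\epsilon$-embedding is a continuous $f\colon X\to Y$ such that $f(x)=f(x')$ implies $d(x,x')<\epsilon$. $\mathrm{Widim}_\epsilon(X,d)$ is the minimum of $\dim K$ over compact metric spaces $K$ admitting an $\epsilon$-embedding $X\to K$. Set $d^T_\Omega(x,x')=\max_{n\in\Omega}d(T^nx,T^nx')$ for finite $\Omega\subset\mathbb{Z}^k$. $[-N,N]^k$ is the integer cube; when intersected with a real subspace it means the real cube. Fix $r>\sqrt{k}/2$. For an $h$-dimensional subspace $V\subseteq\mathbb{R}^k$, let $B_r(V)=\{u\in\mathbb{Z}^k:|u-w|<r\text{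 for some }w\in V\}$, and define $$\mathrm{mdim}(X,T,V)=\lim_{\epsilon\to0}\ \liminf_{N\to\infty}\frac{\mathrm{Widim}_\epsilon\big(X,d^T_{B_r(V)\cap[-N,N]^k}\big)}{\mathrm{vol}_h\big(V\cap[-N,N]^k\big)},$$ where $d$ is a compatible metric and $\mathrm{vol}_0$ of the point $\{0\}$ is $1$; this value is independent of $r$ and $d$. $\langle\vec v\rangle^{\perp}$ is the $(k-1)$-dimensional subspace orthogonal to $\vec v$. *)

theory Defs
  imports "HOL-Analysis.Analysis"
begin

text \<open>Z^k-actions: Z^k is int^'n, k = CARD('n) (so k >= 1 automatically).
  X is a compact subset of a metric space type 'a, with metric dist.\<close>

definition Zk_action :: "'a::metric_space set \<Rightarrow> (int^'n \<Rightarrow> 'a \<Rightarrow> 'a) \<Rightarrow> bool" where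
  "Zk_action X T \<longleftrightarrow> compact X \<and>
     (\<forall>n. continuous_on X (T n) \<and> T n ` X \<subseteq> X) \<and>
     (\<forall>x\<in>X. T 0 x = x) \<and>
     (\<forall>m n. \<forall>x\<in>X. T (m + n) x = T m (T n x))"

definition cw_expansive :: "'a::metric_space set \<Rightarrow> (int^'n \<Rightarrow> 'a \<Rightarrow> 'a) \<Rightarrow> bool" where
  "cw_expansive X T \<longleftrightarrow> (\<exists>c>0. \<forall>A. A \<subseteq> X \<and> A \<noteq> {} \<and> connected A \<and> closed A \<and>
        (\<exists>a\<in>A. \<exists>b\<in>A. a \<noteq> b) \<longrightarrow> (\<exists>n. diameter (T n ` A) > c))"

definition cov_dim_le :: "'a topology \<Rightarrow> nat \<Rightarrow> bool" where
  "cov_dim_le K m \<longleftrightarrow> (\<forall>\<U>. finite \<U> \<and> (\<forall>U\<in>\<U>. openin K U) \<and> topspace K \<subseteq> \<Union>\<U> \<longrightarrow>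
      (\<exists>\<V>. finite \<V> \<and> (\<forall>V\<in>\<V>. openin K V) \<and> topspace K \<subseteq> \<Union>\<V> \<and>
           (\<forall>V\<in>\<V>. \<exists>U\<in>\<U>. V \<subseteq> U) \<and>
           (\<forall>x\<in>topspace K. card {V\<in>\<V>. x \<in> V} \<le> m + 1)))"

definition cov_dim :: "'a topology \<Rightarrow> enat" where
  "cov_dim K = (if \<exists>m. cov_dim_le K m then enat (LEAST m. cov_dim_le K m) else \<infinity>)"

definition Widim_eps :: "real \<Rightarrow> 'a::metric_space set \<Rightarrow> ('a \<Rightarrow> 'a \<Rightarrow> real) \<Rightarrow> enat" where
  "Widim_eps eps X \<rho> = Inf {cov_dim K | (K::'a topology) f. compact_space K \<and> metrizable_space K \<and>
       continuous_map (top_of_set X) K f \<and>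
       (\<forall>x\<in>X. \<forall>x'\<in>X. f x = f x' \<longrightarrow> \<rho> x x' < eps)}"

definition dT :: "(int^'n \<Rightarrow> 'a::metric_space \<Rightarrow> 'a) \<Rightarrow> (int^'n) set \<Rightarrow> 'a \<Rightarrow> 'a \<Rightarrow> real" where
  "dT T \<Omega> x x' = Max ((\<lambda>n. dist (T n x) (T n x')) ` \<Omega>)"

definition real_of_intvec :: "int^'n \<Rightarrow> real^'n" where
  "real_of_intvec u = (\<chi> i. of_int (u $ i))"

definition Bset :: "real \<Rightarrow> (real^'n) set \<Rightarrow> (int^'n) set" where
  "Bset r V = {u. \<exists>w\<in>V. norm (real_of_intvec u - w) < r}"

definition icube :: "nat \<Rightarrow> (int^'n) set" where
  "icube N = {u. \<forall>i. \<bar>u $ i\<bar> \<le> int N}"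

definition rcube :: "nat \<Rightarrow> (real^'n) set" where
  "rcube N = {x. \<forall>i. \<bar>x $ i\<bar> \<le> real N}"

text \<open>h-dimensional volume of a subset S of an h-dimensional subspace V, h = dim V:
  Lebesgue measure on R^h (as PiM over {..<h}) of the preimage of S under the linear
  isometry R^h -> V given by an orthonormal basis of V. For h = 0 this is 1 if 0 \<in> S.\<close>

definition onb :: "(real^'n) set \<Rightarrow> nat \<Rightarrow> real^'n" where
  "onb V = (SOME b. (\<forall>i<dim V. b i \<in> V) \<and>
       (\<forall>i<dim V. \<forall>j<dim V. b i \<bullet> b j = (if i = j then 1 else 0)))"

definition vol_sub :: "(real^'n) set \<Rightarrow> (real^'n) set \<Rightarrow> real" where
  "vol_sub V S = measure (PiM {..<dim V} (\<lambda>_. lborel))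
      {x \<in> space (PiM {..<dim V} (\<lambda>_. lborel)). (\<Sum>i<dim V. x i *\<^sub>R onb V i) \<in> S}"

definition mdim :: "'a::metric_space set \<Rightarrow> (int^'n \<Rightarrow> 'a \<Rightarrow> 'a) \<Rightarrow> real \<Rightarrow> (real^'n) set \<Rightarrow> ereal" where
  "mdim X T r V = Lim (at_right 0) (\<lambda>eps.
      liminf (\<lambda>N. ereal_of_enat (Widim_eps eps X (dT T (Bset r V \<inter> icube N)))
                   / ereal (vol_sub V (V \<inter> rcube N))))"

definition orth_compl :: "real^'n \<Rightarrow> (real^'n) set" where
  "orth_compl v = {x. v \<bullet> x = 0}"

end

(* The key is a cover of small order, whose size is controlled by a shell.  By compactness, expansiveness
   yields a and M0 such that a connected set whose images under T n, n in icube M0, have diameter at most 2a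
   has diameter less than a.  By boundary bumping, a continuum that is a-small along the shell icube R - icube (R - M0) is then
   a-small along all of icube R: otherwise a subcontinuum would reach distance exactly a at some time, which
   cannot lie in the shell, and 2a-smallness around it contradicts the choice of M0.  Hence a continuum that is
   small along the shell is as small as desired along icube N when R = N + M(eps).

   Taking distances to a finite net at the times of the shell as coordinates, we map X to a cube of dimension
   O(N^(k-1)).  Preimages of small cells have small components, so they split into small clopen pieces; a grid
   cover of the cube thus pulls back to a cover of X of small mesh and order O(N^(k-1)), whose nerve map is an
   eps-embedding.  The estimate holds for the whole cube, so neither v nor r enters; and the section
   of the hyperplane by the cube has volume at least a constant times N^(k-1). *)

theory Submission
  imports Defs
begin

section \<open>Grid covers and the width dimension\<close>

lemma connected_component_of_set_top:
  "connected_component_of_set (top_of_set P) x = connected_component_set P x"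
  unfolding connected_component_of_def connected_component_def
  by (auto simp: connectedin_subtopology)

text \<open>In a compact Hausdorff space components and quasi-components coincide, so a component
  inside an open set is separated from the complement by a clopen set. Smallness of components thus
  becomes smallness of clopen pieces.\<close>

lemma compact_component_clopen_nbhd:
  fixes P :: "'a::metric_space set"
  assumes "compact P" "x \<in> P" "openin (top_of_set P) U" "connected_component_set P x \<subseteq> U"
  obtains H where "openin (top_of_set P) H" "closedin (top_of_set P) H" "x \<in> H" "H \<subseteq> U"
proof -
  let ?C = "connected_component_set P x"
  have cc: "?C \<in> connected_components_of (top_of_set P)"
    using \<open>x \<in> P\<close> connected_component_in_connected_components_of[of "top_of_set P" x]
    by (simp add: connected_component_of_set_top)
  have "compact ?C"
    using assms(1) \<open>x \<in> P\<close> closedin_connected_component closedin_compact by blast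
  moreover have "?C \<subseteq> P" by (rule connected_component_subset)
  ultimately have "compactin (top_of_set P) ?C"
    by (simp add: compactin_subtopology)
  moreover have "closedin (top_of_set P) (P - U)"
    using assms(3) by (metis closedin_topspace closedin_diff topspace_euclidean_subtopology)
  moreover have "compact_space (top_of_set P)"
    using assms(1) by (simp add: compact_space_subtopology)
  moreover have "Hausdorff_space (top_of_set P)"
    by (simp add: Hausdorff_space_subtopology)
  ultimately have "separated_between (top_of_set P) ?C (P - U)"
    using assms(4) cc
    by (intro separated_between_compact_connected_component)
       (auto simp: disjnt_def compact_imp_locally_compact_space)
  then obtain H where H: "closedin (top_of_set P) H" "openin (top_of_set P) H" "?C \<subseteq> H" "P - U \<subseteq> P - H"
    unfolding separated_between by auto
  show thesis
  proof
    show "x \<in> H" using H(3) \<open>x \<in> P\<close> by auto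
    show "H \<subseteq> U" using H openin_subset[OF H(2)] by auto
  qed (use H in auto)
qed

text \<open>A finite subcover by clopen sets becomes disjoint when each set loses the earlier ones.
  The differences are still clopen, and they keep \<open>Q\<close> because it passes to
  subsets.\<close>

lemma compact_clopen_partition:
  fixes P :: "'a::metric_space set"
  assumes "compact P"
    and ex: "\<And>x. x \<in> P \<Longrightarrow> \<exists>H. openin (top_of_set P) H \<and> closedin (top_of_set P) H \<and> x \<in> H \<and> Q H"
    and mono: "\<And>H H'. Q H \<Longrightarrow> H' \<subseteq> H \<Longrightarrow> Q H'"
  obtains \<H> where "finite \<H>" "disjoint \<H>" "\<Union>\<H> = P" "\<And>H. H \<in> \<H> \<Longrightarrow> openin (top_of_set P) H \<and> Q H"
proof -
  define \<C> where "\<C> = {H. openin (top_of_set P) H \<and> closedin (top_of_set P) H \<and> Q H}"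
  have "P \<subseteq> \<Union>\<C>" using ex by (auto simp: \<C>_def) 
  then obtain \<D> where D: "\<D> \<subseteq> \<C>" "finite \<D>" "P \<subseteq> \<Union>\<D>"
    using assms(1) unfolding compact_eq_openin_cover \<C>_def by (metis (no_types, lifting) mem_Collect_eq)
  obtain n and f :: "nat \<Rightarrow> 'a set" where f: "\<D> = f ` {i. i < n}"
    using finite_imp_nat_seg_image_inj_on[OF D(2)] by metis
  let ?d = "\<lambda>i. f i - (\<Union>j<i. f j)"
  have clop: "openin (top_of_set P) (?d i)" "Q (?d i)" if "i < n" for i
  proof -
    have *: "openin (top_of_set P) (f j)" "closedin (top_of_set P) (f j)" "Q (f j)" if "j \<le> i" for j
    proof -
      have "f j \<in> \<C>" using D(1) f that \<open>i < n\<close> by auto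
      then show "openin (top_of_set P) (f j)" "closedin (top_of_set P) (f j)" "Q (f j)"
        by (auto simp: \<C>_def)
    qed
    show "openin (top_of_set P) (?d i)"
      by (intro openin_diff closedin_Union) (use * in auto)
    show "Q (?d i)" using *[of i] mono by blast
  qed
  show thesis
  proof (rule that[of "?d ` {..<n}"])
    show "disjoint (?d ` {..<n})"
    proof (rule disjointI)
      fix A B assume AB: "A \<in> ?d ` {..<n}" "B \<in> ?d ` {..<n}" "A \<noteq> B"
      obtain i where i: "A = ?d i" using AB(1) by (rule imageE)
      obtain j where j: "B = ?d j" using AB(2) by (rule imageE)
      have "i \<noteq> j" using i j AB(3) by auto
      then show "A \<inter> B = {}" unfolding i j by (cases i j rule: linorder_cases) auto
    qed
    show "\<Union>(?d ` {..<n}) = P"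
    proof
      show "\<Union>(?d ` {..<n}) \<subseteq> P" using clop(1) openin_imp_subset by blast
      show "P \<subseteq> \<Union>(?d ` {..<n})"
      proof
        fix x assume "x \<in> P"
        then obtain i where i: "i < n" "x \<in> f i" using D(3) f by auto
        define k where "k = (LEAST i. x \<in> f i)"
        have "x \<in> f k" unfolding k_def using i(2) by (rule LeastI)
        moreover have "k \<le> i" unfolding k_def using i(2) by (rule Least_le)
        moreover have "x \<notin> f j" if "j < k" for j
          using not_less_Least[OF that[unfolded k_def]] .
        ultimately have "x \<in> ?d k" "k < n" using i(1) by auto
        then show "x \<in> \<Union>(?d ` {..<n})" by blast
      qed
    qed
  qed (use clop in auto)
qed

text \<open>For each colour \<open>q \<le> m\<close> take the open cells of the grid with mesh \<open>s\<close> shifted by \<open>s * (q + 1) / (m + 2)\<close>.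
  Cells of one colour are disjoint and miss a point only if one of its coordinates lies on the grid.  A nonzero
  coordinate lies on the grid of at most one colour and a zero coordinate on none, so \<open>m + 1\<close> colours cover.\<close>

lemma grid_cover:
  fixes g :: "'i \<Rightarrow> 'a::topological_space \<Rightarrow> real"
  assumes "compact X" "finite I" and cont: "\<And>i. i \<in> I \<Longrightarrow> continuous_on X (g i)"
    and sparse: "\<And>x. x \<in> X \<Longrightarrow> card {i\<in>I. g i x \<noteq> 0} \<le> m" and "s > 0"
  obtains \<V> where "finite \<V>" "\<And>V. V \<in> \<V> \<Longrightarrow> openin (top_of_set X) V" "X \<subseteq> \<Union>\<V>"
    "\<And>x. x \<in> X \<Longrightarrow> card {V\<in>\<V>. x \<in> V} \<le> m + 1"
    "\<And>V p q i. V \<in> \<V> \<Longrightarrow> p \<in> V \<Longrightarrow> q \<in> V \<Longrightarrow> i \<in> I \<Longrightarrow> \<bar>g i p - g i q\<bar> \<le> s"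
proof -
  define h where "h = (\<lambda>q i x. g i x / s - real (q + 1) / real (m + 2))"
  define cell where "cell = (\<lambda>q (k::'i \<Rightarrow> int). {x\<in>X. \<forall>i\<in>I. of_int (k i) < h q i x \<and> h q i x < of_int (k i) + 1})"
  \<comment> \<open>Restricting to \<open>I\<close> makes the cell index extensional: it lies in a
    \<open>PiE\<close>, and two indices that agree on \<open>I\<close> are equal functions.\<close>
  define \<kappa> where "\<kappa> = (\<lambda>q x. \<lambda>i\<in>I. \<lfloor>h q i x\<rfloor>)"
  \<comment> \<open>Only indices realised by points of \<open>X\<close> are used. The functions
    \<open>h q i\<close> are bounded on the compact set \<open>X\<close>, so these indices are
    finite in number.\<close>
  define \<V> where "\<V> = (\<Union>q\<in>{..m}. \<Union>x\<in>X. {cell q (\<kappa> q x)})"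
  have cont_h: "continuous_on X (h q i)" if "i \<in> I" for q i
    unfolding h_def using cont[OF that] \<open>s > 0\<close> by (intro continuous_intros) auto
  have cell_eq: "k i = \<lfloor>h q i x\<rfloor>" if "x \<in> cell q k" "i \<in> I" for x q k i
    using that unfolding cell_def by (intro floor_unique[symmetric]) force+
  have fin: "finite \<V>"
  proof -
    have "\<exists>B. \<forall>x\<in>X. \<bar>h q i x\<bar> \<le> B" if "i \<in> I" for q i
      using compact_imp_bounded[OF compact_continuous_image[OF cont_h[OF that] \<open>compact X\<close>]]
      unfolding bounded_iff by auto
    then have "\<forall>q. \<forall>i\<in>I. \<exists>B. \<forall>x\<in>X. \<bar>h q i x\<bar> \<le> B" by blast
    then obtain B where B: "\<And>q i x. i \<in> I \<Longrightarrow> x \<in> X \<Longrightarrow> \<bar>h q i x\<bar> \<le> B q i"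
      unfolding bchoice_iff choice_iff by blast
    have "finite (\<kappa> q ` X)" for q
    proof (rule finite_subset)
      show "\<kappa> q ` X \<subseteq> (\<Pi>\<^sub>E i\<in>I. {\<lfloor>- B q i\<rfloor>..\<lfloor>B q i\<rfloor>})"
      proof -
        have "\<lfloor>h q i x\<rfloor> \<in> {\<lfloor>- B q i\<rfloor>..\<lfloor>B q i\<rfloor>}" if "i \<in> I" "x \<in> X" for i x
          using B[OF that, of q] by (auto simp: abs_le_iff intro!: floor_mono)
        then show ?thesis unfolding \<kappa>_def by (auto simp: PiE_iff)
      qed
      show "finite (\<Pi>\<^sub>E i\<in>I. {\<lfloor>- B q i\<rfloor>..\<lfloor>B q i\<rfloor>})"
        using \<open>finite I\<close> by (intro finite_PiE) auto
    qed
    moreover have "\<V> = (\<Union>q\<in>{..m}. cell q ` \<kappa> q ` X)" unfolding \<V>_def by auto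
    ultimately show ?thesis by simp
  qed
  have op: "openin (top_of_set X) V" if V_in: "V \<in> \<V>" for V
  proof -
    obtain q k where V: "V = cell q k" using V_in unfolding \<V>_def by blast
    have "openin (top_of_set X) (X \<inter> h q i -` {of_int (k i)<..<of_int (k i) + 1})" if "i \<in> I" for i
      using cont_h[OF that] by (intro continuous_openin_preimage_gen) auto
    then have "openin (top_of_set X) ((\<Inter>i\<in>I. X \<inter> h q i -` {of_int (k i)<..<of_int (k i) + 1}) \<inter> topspace (top_of_set X))"
      using \<open>finite I\<close> by (intro openin_INT) auto
    moreover have "(\<Inter>i\<in>I. X \<inter> h q i -` {of_int (k i)<..<of_int (k i) + 1}) \<inter> topspace (top_of_set X) = V"
      unfolding V cell_def by auto
    ultimately show ?thesis by simp
  qed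
  have cov: "x \<in> \<Union>\<V>" if x: "x \<in> X" for x
  proof -
    define N where "N = {i\<in>I. g i x \<noteq> 0}"
    define Bad where "Bad = (\<lambda>i. {q\<in>{..m}. h q i x \<in> \<int>})"
    have zero: "Bad i = {}" if "i \<in> I - N" for i
    proof -
      have "h q i x \<notin> \<int>" if "q \<le> m" for q
      proof
        assume "h q i x \<in> \<int>"
        then obtain z where "h q i x = of_int z" by (elim Ints_cases)
        then have "- (real (q + 1) / real (m + 2)) = of_int z"
          using \<open>i \<in> I - N\<close> by (simp add: h_def N_def)
        \<comment> \<open>The numerator \<open>q + 1\<close> and the denominator
          \<open>m + 2\<close> keep the shift strictly between 0 and 1 for every colour from 0 to
          \<open>m\<close>.\<close>
        moreover have "- (real (q + 1) / real (m + 2)) < 0" "- (real (q + 1) / real (m + 2)) > -1"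
          using that by (auto simp: field_simps)
        ultimately have "of_int z < (of_int 0 :: real)" "of_int (-1) < (of_int z :: real)" by simp_all
        then have "z < 0" "-1 < z" unfolding of_int_less_iff .
        then show False by simp
      qed
      then show ?thesis by (auto simp: Bad_def)
    qed
    have one: "card (Bad i) \<le> 1" for i
    proof -
      have "q = q'" if "q \<in> Bad i" "q' \<in> Bad i" for q q'
      proof -
        have "h q i x - h q' i x \<in> \<int>" using that by (auto simp: Bad_def)
        then obtain z where z: "h q i x - h q' i x = of_int z" by (elim Ints_cases)
        have "h q i x - h q' i x = (real q' - real q) / real (m + 2)"
          by (simp add: h_def diff_divide_distrib add_divide_distrib)
        moreover have "\<bar>(real q' - real q) / real (m + 2)\<bar> < 1"
          using that by (auto simp: Bad_def field_simps)
        ultimately have "\<bar>of_int z :: real\<bar> < 1" using z by simp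
        then have "of_int \<bar>z\<bar> < (of_int 1 :: real)" by simp
        then have "z = 0" unfolding of_int_less_iff by simp
        then show ?thesis using z by (simp add: h_def)
      qed
      then show ?thesis by (metis (full_types) Bad_def card_le_Suc0_iff_eq finite_Collect_conjI finite_atMost One_nat_def Collect_mem_eq)
    qed
    \<comment> \<open>Each nonzero coordinate spoils at most one colour, so at most \<open>m\<close>
      of the \<open>m + 1\<close> colours are spoiled and one is left over.\<close>
    have "card (\<Union>i\<in>I. Bad i) \<le> card (\<Union>i\<in>N. Bad i)"
      using zero \<open>finite I\<close> by (intro card_mono) (auto simp: N_def Bad_def)
    also have "\<dots> \<le> (\<Sum>i\<in>N. card (Bad i))" using \<open>finite I\<close> by (intro card_UN_le) (simp add: N_def)
    also have "\<dots> \<le> (\<Sum>i\<in>N. 1)" using one by (rule sum_mono)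
    also have "\<dots> < card {..m}" using sparse[OF x] by (simp add: N_def)
    finally have "\<not> {..m} \<subseteq> (\<Union>i\<in>I. Bad i)"
      using \<open>finite I\<close> card_mono[of "\<Union>i\<in>I. Bad i" "{..m}"] by (force simp: Bad_def)
    then obtain q where q: "q \<le> m" "\<And>i. i \<in> I \<Longrightarrow> h q i x \<notin> \<int>" by (auto simp: Bad_def)
    have "x \<in> cell q (\<kappa> q x)"
    proof -
      have "of_int \<lfloor>h q i x\<rfloor> < h q i x \<and> h q i x < of_int \<lfloor>h q i x\<rfloor> + 1" if "i \<in> I" for i
      proof -
        have "h q i x \<noteq> of_int \<lfloor>h q i x\<rfloor>" using q(2)[OF that] range_eqI[of "h q i x" of_int] unfolding Ints_def by blast
        then show ?thesis by linarith
      qed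
      then show ?thesis unfolding cell_def \<kappa>_def using x by simp
    qed
    then show ?thesis using q(1) x by (force simp: \<V>_def)
  qed
  have ord: "card {V\<in>\<V>. x \<in> V} \<le> m + 1" if x: "x \<in> X" for x
  proof -
    have "V \<in> (\<lambda>q. cell q (\<kappa> q x)) ` {..m}" if V: "V \<in> \<V>" "x \<in> V" for V
    proof -
      obtain q y where qy: "q \<le> m" "V = cell q (\<kappa> q y)" using V unfolding \<V>_def by blast
      have "\<kappa> q y = \<kappa> q x"
      proof
        fix i
        show "\<kappa> q y i = \<kappa> q x i"
          using cell_eq[of x q "\<kappa> q y" i] qy V(2) by (cases "i \<in> I") (auto simp: \<kappa>_def)
      qed
      then show ?thesis using qy by auto
    qed
    then have "card {V\<in>\<V>. x \<in> V} \<le> card ((\<lambda>q. cell q (\<kappa> q x)) ` {..m})"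
      by (intro card_mono) auto
    also have "\<dots> \<le> m + 1" using card_image_le[of "{..m}"] by auto
    finally show ?thesis .
  qed
  have mesh: "\<bar>g i p - g i q\<bar> \<le> s" if V: "V \<in> \<V>" "p \<in> V" "q \<in> V" "i \<in> I" for V p q i
  proof -
    obtain r k where rk: "V = cell r k" using V(1) unfolding \<V>_def by blast
    have "\<bar>h r i p - h r i q\<bar> \<le> 1" 
    proof -
      have "of_int (k i) < h r i x \<and> h r i x < of_int (k i) + 1" if "x \<in> V" for x
        using that V(4) unfolding rk cell_def by blast
      from this[OF V(2)] this[OF V(3)] show ?thesis by linarith
    qed
    moreover have "h r i p - h r i q = (g i p - g i q) / s" by (simp add: h_def diff_divide_distrib)
    ultimately have "\<bar>g i p - g i q\<bar> / s \<le> 1" using \<open>s > 0\<close> by (simp add: abs_divide)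
    then show ?thesis using \<open>s > 0\<close> by (simp add: pos_divide_le_eq)
  qed
  have "X \<subseteq> \<Union>\<V>" using cov by (rule subsetI)
  with fin op show thesis using ord mesh by (rule that)
qed

section \<open>Covering dimension and the maps defined by covers\<close>

lemma cov_dim_le_homeomorphic:
  assumes hom: "homeomorphic_maps K L f g" and L: "cov_dim_le L m"
  shows "cov_dim_le K m"
  unfolding cov_dim_le_def
proof (intro allI impI)
  fix \<U> assume U: "finite \<U> \<and> (\<forall>U\<in>\<U>. openin K U) \<and> topspace K \<subseteq> \<Union>\<U>"
  have cf: "continuous_map K L f" and cg: "continuous_map L K g"
    and gf: "\<And>x. x \<in> topspace K \<Longrightarrow> g (f x) = x" and fg: "\<And>y. y \<in> topspace L \<Longrightarrow> f (g y) = y"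
    using hom by (auto simp: homeomorphic_maps_def)
  let ?pull = "\<lambda>U. {y \<in> topspace L. g y \<in> U}" and ?push = "\<lambda>V. {x \<in> topspace K. f x \<in> V}"
  have "finite (?pull ` \<U>) \<and> (\<forall>U\<in>?pull ` \<U>. openin L U) \<and> topspace L \<subseteq> \<Union>(?pull ` \<U>)"
    using U openin_continuous_map_preimage[OF cg] continuous_map_image_subset_topspace[OF cg]
    by (auto simp: image_subset_iff)
  then obtain \<V> where V: "finite \<V>" "\<forall>V\<in>\<V>. openin L V" "topspace L \<subseteq> \<Union>\<V>"
    "\<forall>V\<in>\<V>. \<exists>U\<in>?pull ` \<U>. V \<subseteq> U" "\<forall>x\<in>topspace L. card {V\<in>\<V>. x \<in> V} \<le> m + 1"
    using L[unfolded cov_dim_le_def, rule_format, of "?pull ` \<U>"] by blast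
  have fK: "f x \<in> topspace L" if "x \<in> topspace K" for x
    using continuous_map_image_subset_topspace[OF cf] that by auto
  show "\<exists>\<V>. finite \<V> \<and> (\<forall>V\<in>\<V>. openin K V) \<and> topspace K \<subseteq> \<Union>\<V> \<and>
           (\<forall>V\<in>\<V>. \<exists>U\<in>\<U>. V \<subseteq> U) \<and> (\<forall>x\<in>topspace K. card {V\<in>\<V>. x \<in> V} \<le> m + 1)"
  proof (intro exI[of _ "?push ` \<V>"] conjI ballI)
    show "finite (?push ` \<V>)" using V(1) by simp
    show "openin K W" if "W \<in> ?push ` \<V>" for W
      using that V(2) openin_continuous_map_preimage[OF cf] by auto
    show "topspace K \<subseteq> \<Union>(?push ` \<V>)" using V(3) fK by fastforce
    show "\<exists>U\<in>\<U>. W \<subseteq> U" if W: "W \<in> ?push ` \<V>" for W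
    proof -
      obtain V' where V': "V' \<in> \<V>" "W = ?push V'" using W by (elim imageE) auto
      then obtain U where U': "U \<in> \<U>" "V' \<subseteq> ?pull U" using V(4) by auto
      have "W \<subseteq> U"
      proof
        fix x assume "x \<in> W"
        then have "x \<in> topspace K" "f x \<in> ?pull U" using V'(2) U'(2) by auto
        then show "x \<in> U" using gf by simp
      qed
      then show ?thesis using U'(1) by blast
    qed
    show "card {W\<in>?push ` \<V>. x \<in> W} \<le> m + 1" if x: "x \<in> topspace K" for x
    proof -
      have "card {W\<in>?push ` \<V>. x \<in> W} \<le> card (?push ` {V\<in>\<V>. f x \<in> V})"
        using V(1) by (intro card_mono) auto
      also have "\<dots> \<le> card {V\<in>\<V>. f x \<in> V}" using V(1) by (intro card_image_le) simp
      also have "\<dots> \<le> m + 1" using V(5) fK[OF x] by blast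
      finally show ?thesis .
    qed
  qed
qed

lemma cov_dim_leI: "cov_dim_le K m \<Longrightarrow> cov_dim K \<le> enat m"
  unfolding cov_dim_def by (auto intro: Least_le)

text \<open>The metric on \<open>nat \<Rightarrow> real\<close> sums the truncated coordinate
  distances with weights \<open>(1/2) ^ n\<close>, and these weights add up to 2.\<close>

lemma dist_fun_le_of_coordinates:
  fixes p q :: "nat \<Rightarrow> real"
  assumes "\<And>i. \<bar>p i - q i\<bar> \<le> s"
  shows "dist p q \<le> 2 * s"
proof -
  have sm: "summable (\<lambda>n. (1/2::real) ^ n * s)" "(\<Sum>n. (1/2::real) ^ n * s) = 2 * s"
    using suminf_mult2[of "\<lambda>n. (1/2::real)^n" s] by (auto simp: suminf_geometric intro!: summable_mult2)
  have "dist p q = (\<Sum>n. (1/2) ^ n * min (dist (p (from_nat n)) (q (from_nat n))) 1)"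
    by (simp add: dist_fun_def)
  also have "\<dots> \<le> (\<Sum>n. (1/2) ^ n * s)"
  proof (rule suminf_le)
    show "(1/2) ^ n * min (dist (p (from_nat n)) (q (from_nat n))) 1 \<le> (1/2) ^ n * s" for n
      using assms[of "from_nat n"] by (auto simp: dist_real_def min_def)
    show "summable (\<lambda>n. (1/2) ^ n * min (dist (p (from_nat n)) (q (from_nat n))) 1)"
    proof (rule summable_comparison_test'[OF sm(1), of 0])
      show "norm ((1/2) ^ n * min (dist (p (from_nat n)) (q (from_nat n))) 1) \<le> (1/2) ^ n * s" for n
        using assms[of "from_nat n"] by (auto simp: dist_real_def min_def)
    qed
  qed (rule sm)
  finally show ?thesis using sm(2) by simp
qed

text \<open>Such a set lies in a finite union of \<open>m\<close>-dimensional coordinate subspaces.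
  Applied to the coordinates themselves, \<open>grid_cover\<close> gives covers of order
  \<open>m + 1\<close> and arbitrarily small mesh, and a Lebesgue number of the given cover turns a
  fine one into a refinement.\<close>

lemma cov_dim_le_sparse:
  fixes Y :: "(nat \<Rightarrow> real) set"
  assumes "compact Y" and supp: "\<And>y i. y \<in> Y \<Longrightarrow> i \<ge> n \<Longrightarrow> y i = 0"
    and sparse: "\<And>y. y \<in> Y \<Longrightarrow> card {i. i < n \<and> y i \<noteq> 0} \<le> m"
  shows "cov_dim_le (top_of_set Y) m"
  unfolding cov_dim_le_def
proof (intro allI impI)
  fix \<U> assume U: "finite \<U> \<and> (\<forall>U\<in>\<U>. openin (top_of_set Y) U) \<and> topspace (top_of_set Y) \<subseteq> \<Union>\<U>"
  \<comment> \<open>The Lebesgue number lemma speaks of sets open in the ambient space, so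
    relatively open sets are replaced by open sets that cut them out.\<close>
  define \<G> where "\<G> = {G. open G \<and> Y \<inter> G \<in> \<U>}"
  have cov: "Y \<subseteq> \<Union>\<G>"
  proof
    fix y assume "y \<in> Y"
    then obtain U where "U \<in> \<U>" "y \<in> U" using U by auto
    then obtain G where "open G" "U = Y \<inter> G" using U by (meson openin_open)
    then show "y \<in> \<Union>\<G>" using \<open>U \<in> \<U>\<close> \<open>y \<in> U\<close> by (auto simp: \<G>_def)
  qed
  have "open G" if "G \<in> \<G>" for G using that by (simp add: \<G>_def)
  from Heine_Borel_lemma[OF assms(1) cov this]
  obtain e where e: "e > 0" "\<And>y. y \<in> Y \<Longrightarrow> \<exists>G\<in>\<G>. ball y e \<subseteq> G" by blast
  have cont: "continuous_on Y (\<lambda>y. y i)" for i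
    using continuous_on_product_coordinates by (rule continuous_on_subset) simp
  have sparse': "card {i \<in> {..<n}. y i \<noteq> 0} \<le> m" if "y \<in> Y" for y using sparse[OF that] by simp
  \<comment> \<open>Coordinates within \<open>e / 4\<close> give distance at most
    \<open>e / 2\<close>, which is strictly below the Lebesgue number \<open>e\<close>.\<close>
  have quarter: "e / 4 > 0" using e(1) by simp
  obtain \<V> where V: "finite \<V>" "\<And>V. V \<in> \<V> \<Longrightarrow> openin (top_of_set Y) V" "Y \<subseteq> \<Union>\<V>"
    "\<And>y. y \<in> Y \<Longrightarrow> card {V\<in>\<V>. y \<in> V} \<le> m + 1"
    "\<And>V p q i. V \<in> \<V> \<Longrightarrow> p \<in> V \<Longrightarrow> q \<in> V \<Longrightarrow> i \<in> {..<n} \<Longrightarrow> \<bar>p i - q i\<bar> \<le> e / 4"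
    by (rule grid_cover[where g = "\<lambda>i y. y i", OF assms(1) finite_lessThan cont sparse' quarter]) (assumption, rule that)
  show "\<exists>\<V>. finite \<V> \<and> (\<forall>V\<in>\<V>. openin (top_of_set Y) V) \<and> topspace (top_of_set Y) \<subseteq> \<Union>\<V> \<and>
           (\<forall>V\<in>\<V>. \<exists>U\<in>\<U>. V \<subseteq> U) \<and> (\<forall>x\<in>topspace (top_of_set Y). card {V\<in>\<V>. x \<in> V} \<le> m + 1)"
  \<comment> \<open>The empty cell is dropped because a refining set is located through one of its
    points.\<close>
  proof (intro exI[of _ "\<V> - {{}}"] conjI ballI)
    show "\<exists>U\<in>\<U>. V \<subseteq> U" if "V \<in> \<V> - {{}}" for V
    proof -
      obtain y where y: "y \<in> V" using \<open>V \<in> \<V> - {{}}\<close> by blast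
      have VY: "V \<subseteq> Y" using V(2)[of V] \<open>V \<in> \<V> - {{}}\<close> openin_imp_subset by blast
      obtain G where G: "G \<in> \<G>" "ball y e \<subseteq> G" using e(2) y VY by blast
      have "V \<subseteq> ball y e"
      proof
        fix p assume p: "p \<in> V"
        have "\<bar>y i - p i\<bar> \<le> e / 4" for i
        proof (cases "i < n")
          case True
          then show ?thesis using V(5)[of V y p i] y p \<open>V \<in> \<V> - {{}}\<close> by auto
        next
          case False
          then have "y i = 0" "p i = 0" using supp y p VY by auto
          then show ?thesis using e(1) by simp
        qed
        then have "dist y p \<le> 2 * (e / 4)" by (rule dist_fun_le_of_coordinates)
        then show "p \<in> ball y e" using e(1) by simp
      qed
      then have "V \<subseteq> Y \<inter> G" using VY G by blast
      moreover have "Y \<inter> G \<in> \<U>" using G(1) by (simp add: \<G>_def)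
      ultimately show ?thesis by blast
    qed
    show "card {V\<in>\<V> - {{}}. x \<in> V} \<le> m + 1" if "x \<in> topspace (top_of_set Y)" for x
    proof -
      have "{V\<in>\<V> - {{}}. x \<in> V} = {V\<in>\<V>. x \<in> V}" by auto
      then show ?thesis using V(4) that by simp
    qed
  qed (use V in auto)
qed

text \<open>The coordinates of \<open>f\<close> are distances to the complements of the cover
  members, so they record which members contain a point. Points with equal images share a member,
  hence are \<open>eps\<close>-close, and at most \<open>m\<close> coordinates are nonzero at once.
  The coordinates are not normalised to a simplex, so the bound is \<open>m\<close> and not
  \<open>m - 1\<close>.\<close>

lemma Widim_eps_le:
  fixes X :: "'a::metric_space set"
  assumes "compact X" "finite \<W>" and op: "\<And>W. W \<in> \<W> \<Longrightarrow> openin (top_of_set X) W"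
    and cov: "X \<subseteq> \<Union>\<W>" and ord: "\<And>x. x \<in> X \<Longrightarrow> card {W\<in>\<W>. x \<in> W} \<le> m"
    and small: "\<And>W p q. W \<in> \<W> \<Longrightarrow> p \<in> W \<Longrightarrow> q \<in> W \<Longrightarrow> \<rho> p q < eps"
  shows "Widim_eps eps X \<rho> \<le> enat m"
proof -
  define n where "n = card \<W>"
  obtain e where e: "bij_betw e {..<n} \<W>"
    using ex_bij_betw_nat_finite[OF assms(2)] unfolding n_def lessThan_atLeast0 by blast
  \<comment> \<open>\<open>infdist\<close> to the empty set is 0, so a member equal to
    \<open>X\<close> needs the constant 1 to be recorded by a nonzero coordinate.\<close>
  define f :: "'a \<Rightarrow> nat \<Rightarrow> real"
    where "f = (\<lambda>x i. if i < n then if e i = X then 1 else infdist x (X - e i) else 0)"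
  have eW: "e i \<in> \<W>" if "i < n" for i using e that by (auto simp: bij_betw_def)
  have nz: "f x i \<noteq> 0 \<longleftrightarrow> x \<in> e i" if "x \<in> X" "i < n" for x i
  proof (cases "e i = X")
    case True
    then show ?thesis using that by (simp add: f_def)
  next
    case False
    have "e i \<subseteq> X" using op[OF eW] that openin_imp_subset by blast
    moreover have "closed (X - e i)"
    proof -
      have "closedin (top_of_set X) (X - e i)"
        using op[OF eW[OF that(2)]] by (metis closedin_diff closedin_topspace topspace_euclidean_subtopology)
      then show ?thesis using assms(1) closedin_compact compact_imp_closed by blast
    qed
    ultimately show ?thesis using that False in_closed_iff_infdist_zero[of "X - e i" x]
      by (auto simp: f_def)
  qed
  have contf: "continuous_on X f"
  proof (rule continuous_on_coordinatewise_then_product)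
    show "continuous_on X (\<lambda>x. f x i)" for i
      unfolding f_def by (cases "i < n"; cases "e i = X") (auto intro!: continuous_intros)
  qed
  define Y where "Y = f ` X"
  have "compact Y" unfolding Y_def using contf assms(1) by (rule compact_continuous_image)
  have Ydim: "cov_dim_le (top_of_set Y) m"
  proof (rule cov_dim_le_sparse[OF \<open>compact Y\<close>, of n])
    show "y i = 0" if "y \<in> Y" "i \<ge> n" for y i using that by (auto simp: Y_def f_def)
    show "card {i. i < n \<and> y i \<noteq> 0} \<le> m" if "y \<in> Y" for y
    proof -
      obtain x where x: "x \<in> X" "y = f x" using \<open>y \<in> Y\<close> Y_def by auto
      have "{i. i < n \<and> y i \<noteq> 0} = {i. i < n \<and> x \<in> e i}" using nz x by auto
      moreover have "card {i. i < n \<and> x \<in> e i} = card (e ` {i. i < n \<and> x \<in> e i})"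
        using e by (intro card_image[symmetric]) (auto simp: bij_betw_def inj_on_def)
      moreover have "\<dots> \<le> card {W\<in>\<W>. x \<in> W}"
        using assms(2) eW by (intro card_mono) auto
      ultimately show ?thesis using ord[OF x(1)] by simp
    qed
  qed
  \<comment> \<open>\<^const>\<open>Widim_eps\<close> only admits spaces with points in \<^typ>\<open>'a\<close>, so \<open>Y\<close> is transported along a section of \<open>f\<close>.\<close>
  define r where "r = inv_into X f"
  define K where "K = pullback_topology (r ` Y) f (top_of_set Y)"
  have fr: "f (r y) = y" "r y \<in> X" if "y \<in> Y" for y
    using that by (auto simp: Y_def r_def f_inv_into_f inv_into_into)
  have topK: "topspace K = r ` Y"
    using fr by (auto simp: K_def topspace_pullback_topology)
  have openK: "openin K S \<longleftrightarrow> (\<exists>U. openin (top_of_set Y) U \<and> S = f -` U \<inter> r ` Y)" for S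
    by (simp add: K_def openin_pullback_topology)
  have hom: "homeomorphic_maps K (top_of_set Y) f r"
    unfolding homeomorphic_maps_def
  proof (intro conjI ballI)
    show "continuous_map K (top_of_set Y) f"
      unfolding continuous_map_def topK openK using fr by auto
    show "continuous_map (top_of_set Y) K r"
      unfolding continuous_map_def topK openK
    proof (intro conjI allI impI)
      fix U assume "\<exists>U'. openin (top_of_set Y) U' \<and> U = f -` U' \<inter> r ` Y"
      then obtain U' where U': "openin (top_of_set Y) U'" "U = f -` U' \<inter> r ` Y" by blast
      have "r y \<in> U \<longleftrightarrow> y \<in> U'" if "y \<in> Y" for y
        using that fr(1)[OF that] by (simp add: U'(2))
      then have "{y \<in> topspace (top_of_set Y). r y \<in> U} = U'"
        using openin_imp_subset[OF U'(1)] by auto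
      then show "openin (top_of_set Y) {y \<in> topspace (top_of_set Y). r y \<in> U}" using U' by simp
    qed auto
    show "r (f x) = x" if "x \<in> topspace K" for x
      using that fr unfolding topK by auto
    show "f (r y) = y" if "y \<in> topspace (top_of_set Y)" for y
      using that fr by simp
  qed
  have K: "K homeomorphic_space top_of_set Y"
    using hom homeomorphic_space_def by blast
  have "Widim_eps eps X \<rho> \<le> cov_dim K"
    unfolding Widim_eps_def
  proof (rule Inf_lower, rule CollectI, intro exI[of _ K] exI[of _ "r \<circ> f"] conjI ballI impI)
    show "compact_space K"
      using homeomorphic_compact_space[OF K] \<open>compact Y\<close> by (simp add: compact_space_subtopology)
    show "metrizable_space K"
      using homeomorphic_metrizable_space[OF K] metrizable_space_euclidean metrizable_space_subtopology by blast
    show "continuous_map (top_of_set X) K (r \<circ> f)"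
    proof (rule continuous_map_compose)
      show "continuous_map (top_of_set X) (top_of_set Y) f"
        using contf by (auto simp: Y_def continuous_map_in_subtopology)
      show "continuous_map (top_of_set Y) K r" using hom by (simp add: homeomorphic_maps_def)
    qed
    show "\<rho> x x' < eps" if "x \<in> X" "x' \<in> X" "(r \<circ> f) x = (r \<circ> f) x'" for x x'
    proof -
      have eq: "f x = f x'"
      proof -
        have "f (r (f x)) = f (r (f x'))" using that(3) by simp
        then show ?thesis using fr(1)[of "f x"] fr(1)[of "f x'"] that(1,2) unfolding Y_def by auto
      qed
      obtain W where W: "W \<in> \<W>" "x \<in> W" using cov \<open>x \<in> X\<close> by blast
      obtain i where i: "i < n" "W = e i" using e W(1) by (auto simp: bij_betw_def)
      have "x' \<in> W" using nz[of x i] nz[of x' i] eq W i that by simp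
      then show ?thesis using small W by blast
    qed
  qed simp
  also have "\<dots> \<le> enat m"
    using cov_dim_le_homeomorphic[OF hom Ydim] by (rule cov_dim_leI)
  finally show ?thesis .
qed

section \<open>Small continua of a continuum-wise expansive action\<close>

lemma zero_in_icube [simp]: "0 \<in> icube N"
  by (simp add: icube_def)

lemma icube_mono: "M \<le> N \<Longrightarrow> icube M \<subseteq> icube N"
  by (auto simp: icube_def intro: order.trans)

lemma icube_add: "m \<in> icube M \<Longrightarrow> n \<in> icube N \<Longrightarrow> m + n \<in> icube (M + N)"
  unfolding icube_def by (auto intro!: order.trans[OF abs_triangle_ineq] add_mono)

lemma ex_in_icube: "\<exists>N. n \<in> icube N" for n :: "int^'n"
proof -
  have "\<bar>n $ i\<bar> \<le> int (nat (\<Sum>j\<in>UNIV. \<bar>n $ j\<bar>))" for i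
    using member_le_sum[of i UNIV "\<lambda>j. \<bar>n $ j\<bar>"] by simp
  then have "n \<in> icube (nat (\<Sum>j\<in>UNIV. \<bar>n $ j\<bar>))" unfolding icube_def by blast
  then show ?thesis by blast
qed

lemma finite_icube: "finite (icube N :: (int^'n) set)"
  and card_icube: "card (icube N :: (int^'n) set) = (2 * N + 1) ^ CARD('n)"
proof -
  let ?P = "\<Pi>\<^sub>E i\<in>(UNIV::'n set). {- int N..int N}"
  have "bij_betw vec_nth (icube N :: (int^'n) set) ?P"
  proof (rule bij_betwI[where g = vec_lambda])
    show "vec_nth \<in> icube N \<rightarrow> ?P" by (auto simp: icube_def abs_le_iff minus_le_iff)
    show "vec_lambda \<in> ?P \<rightarrow> icube N"
      by (auto simp: icube_def abs_le_iff PiE_iff minus_le_iff)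
  qed (auto simp: vec_nth_inverse)
  moreover have "finite ?P" by (intro finite_PiE) auto
  moreover have "card ?P = (2 * N + 1) ^ CARD('n)"
    by (subst card_PiE) (auto simp: prod_constant nat_add_distrib nat_mult_distrib)
  ultimately show "finite (icube N :: (int^'n) set)" "card (icube N :: (int^'n) set) = (2 * N + 1) ^ CARD('n)"
    using bij_betw_finite bij_betw_same_card by metis+
qed

section \<open>Limits of continua and uniform expansiveness\<close>

lemma LIMSEQ_in_closure:
  assumes "s \<longlonglongrightarrow> z" "\<And>i. i \<ge> j \<Longrightarrow> s i \<in> S"
  shows "z \<in> closure S"
proof (rule Lim_in_closed_set[OF closed_closure _ _ assms(1)])
  show "\<forall>\<^sub>F i in sequentially. s i \<in> closure S"
    using assms(2) closure_subset by (auto simp: eventually_sequentially)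
qed simp

text \<open>A separation of the limit set would give a function \<open>\<phi>\<close> that changes sign on infinitely many
  \<open>A i\<close>, because every \<open>A i\<close> comes close to \<open>x\<close>; its zeros accumulate in the limit set.\<close>

lemma connected_upper_limit:
  fixes A :: "nat \<Rightarrow> 'a::metric_space set"
  assumes "compact X" and sub: "\<And>j. A j \<subseteq> X" and conn: "\<And>j. connected (A j)"
    and pA: "\<And>j. p j \<in> A j" and lim: "p \<longlonglongrightarrow> x"
  shows "connected (\<Inter>j. closure (\<Union>i\<in>{j..}. A i))"
proof -
  define L where "L = (\<Inter>j. closure (\<Union>i\<in>{j..}. A i))"
  have "closed L" unfolding L_def by auto
  have "x \<in> L"
    unfolding L_def
  proof
    fix j
    show "x \<in> closure (\<Union>i\<in>{j..}. A i)"
      using lim by (rule LIMSEQ_in_closure[where j = j]) (use pA in blast)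
  qed
  have False if P: "closed P" "closed Q" "P \<union> Q = L" "P \<inter> Q = {}" "x \<in> P" "b \<in> Q" for P Q b
  proof -
    \<comment> \<open>\<open>\<phi>\<close> is negative on \<open>P\<close> and positive on
      \<open>Q\<close>, because these closed sets are disjoint. It therefore has no zero in
      \<open>L\<close>, and a zero in \<open>L\<close> is the contradiction sought.\<close>
    define \<phi> where "\<phi> = (\<lambda>w. infdist w P - infdist w Q)"
    have cont: "continuous_on UNIV \<phi>" unfolding \<phi>_def by (intro continuous_intros)
    have ne: "P \<noteq> {}" "Q \<noteq> {}" using P by auto
    have "\<phi> x < 0"
    proof -
      have "infdist x P = 0" using P(5) by simp
      moreover have "infdist x Q \<noteq> 0" using in_closed_iff_infdist_zero[OF P(2) ne(2), of x] P by auto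
      ultimately show ?thesis using infdist_nonneg[of x Q] by (simp add: \<phi>_def)
    qed
    have "\<phi> b > 0"
    proof -
      have "infdist b Q = 0" using P(6) by simp
      moreover have "infdist b P \<noteq> 0" using in_closed_iff_infdist_zero[OF P(1) ne(1), of b] P by auto
      ultimately show ?thesis using infdist_nonneg[of b P] by (simp add: \<phi>_def)
    qed
    have zero: "\<exists>i\<ge>j. \<exists>w\<in>A i. \<phi> w = 0" for j
    proof -
      have "(\<lambda>i. \<phi> (p i)) \<longlonglongrightarrow> \<phi> x"
        using cont lim by (rule continuous_on_tendsto_compose) auto
      then have "\<forall>\<^sub>F i in sequentially. \<phi> (p i) < 0" using \<open>\<phi> x < 0\<close> by (rule order_tendstoD)
      then obtain j' where j': "\<And>i. i \<ge> j' \<Longrightarrow> \<phi> (p i) < 0" by (auto simp: eventually_sequentially)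
      \<comment> \<open>Beyond \<open>k\<close> the points \<open>p i\<close> are on the negative
        side, while some \<open>A i\<close> reaches the positive side near \<open>b\<close>. By
        connectedness that \<open>A i\<close> contains a zero.\<close>
      define k where "k = max j j'"
      have "open {w. \<phi> w > 0}" using cont by (intro open_Collect_less) (auto simp: continuous_on_const)
      moreover have "b \<in> closure (\<Union>i\<in>{k..}. A i)" using P by (auto simp: L_def)
      ultimately have "{w. \<phi> w > 0} \<inter> (\<Union>i\<in>{k..}. A i) \<noteq> {}"
        using \<open>\<phi> b > 0\<close> open_Int_closure_eq_empty by blast
      then obtain i u where i: "i \<ge> k" "u \<in> A i" "\<phi> u > 0" by auto
      have "connected (\<phi> ` A i)"
        using conn cont by (intro connected_continuous_image) (auto intro: continuous_on_subset)
      then have "0 \<in> \<phi> ` A i"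
        using connectedD_interval[of "\<phi> ` A i" "\<phi> (p i)" "\<phi> u" 0] i j'[of i] pA[of i]
        by (simp add: k_def)
      then obtain w where "w \<in> A i" "\<phi> w = 0" by auto
      moreover have "j \<le> i" using i(1) by (simp add: k_def)
      ultimately show ?thesis by blast
    qed
    then obtain I w where Iw: "\<And>j. I j \<ge> j \<and> w j \<in> A (I j) \<and> \<phi> (w j) = 0" by metis
    have "\<forall>j. w j \<in> X" using Iw sub by blast
    then obtain z r where z: "z \<in> X" "strict_mono r" "(w \<circ> r) \<longlonglongrightarrow> z"
      using \<open>compact X\<close> unfolding compact_def by metis
    have "(\<lambda>i. \<phi> ((w \<circ> r) i)) \<longlonglongrightarrow> \<phi> z"
      using cont z(3) by (rule continuous_on_tendsto_compose) auto
    moreover have "(\<lambda>i. \<phi> ((w \<circ> r) i)) = (\<lambda>i. 0)" using Iw by auto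
    ultimately have "\<phi> z = 0" using LIMSEQ_unique tendsto_const by metis
    have "z \<in> L"
      unfolding L_def
    proof
      fix j
      show "z \<in> closure (\<Union>i\<in>{j..}. A i)"
        using z(3)
      proof (rule LIMSEQ_in_closure)
        fix i assume "i \<ge> j"
        then have "j \<le> I (r i)"
          using seq_suble[OF z(2), of i] Iw[of "r i"] by linarith
        then show "(w \<circ> r) i \<in> (\<Union>i\<in>{j..}. A i)" using Iw[of "r i"] by auto
      qed
    qed
    then consider "z \<in> P" | "z \<in> Q" using P by blast
    then show False
    proof cases
      case 1
      then have "infdist z P = 0" by simp
      then have "infdist z Q = 0" using \<open>\<phi> z = 0\<close> by (simp add: \<phi>_def)
      then show False using in_closed_iff_infdist_zero[OF P(2) ne(2), of z] 1 P by auto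
    next
      case 2
      then have "infdist z Q = 0" by simp
      then have "infdist z P = 0" using \<open>\<phi> z = 0\<close> by (simp add: \<phi>_def)
      then show False using in_closed_iff_infdist_zero[OF P(1) ne(1), of z] 2 P by auto
    qed
  qed
  note sep = this
  have "connected L"
    unfolding connected_closed_set[OF \<open>closed L\<close>]
  proof (intro notI, elim exE conjE)
    fix P Q assume *: "closed P" "closed Q" "P \<noteq> {}" "Q \<noteq> {}" "P \<union> Q = L" "P \<inter> Q = {}"
    consider "x \<in> P" | "x \<in> Q" using * \<open>x \<in> L\<close> by blast
    then show False
    proof cases
      case 1 then show False using sep[of P Q] * by blast
    next
      case 2
      moreover have "Q \<union> P = L" "Q \<inter> P = {}" using * by auto
      ultimately show False using sep[of Q P] * by blast
    qed
  qed
  then show ?thesis by (simp add: L_def)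
qed

text \<open>Otherwise there are connected sets that are \<open>c / 2\<close>-small over ever larger
  cubes but contain two points at distance at least \<delta>. Their upper limit along a subsequence
  is a nondegenerate continuum all of whose images have diameter at most \<open>c\<close>, against
  expansiveness.\<close>

lemma cw_expansive_uniform:
  fixes X :: "'a::metric_space set" and T :: "int^'n \<Rightarrow> 'a \<Rightarrow> 'a"
  assumes act: "Zk_action X T" and "c > 0" and "\<delta> > 0"
    and cw: "\<And>A. A \<subseteq> X \<Longrightarrow> A \<noteq> {} \<Longrightarrow> connected A \<Longrightarrow> closed A \<Longrightarrow> \<exists>a\<in>A. \<exists>b\<in>A. a \<noteq> b
              \<Longrightarrow> \<exists>n. diameter (T n ` A) > c"
  shows "\<exists>M. \<forall>A. A \<subseteq> X \<and> connected A \<and>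
    (\<forall>n\<in>icube M. \<forall>p\<in>A. \<forall>q\<in>A. dist (T n p) (T n q) \<le> c / 2) \<longrightarrow> (\<forall>p\<in>A. \<forall>q\<in>A. dist p q < \<delta>)"
    (is "\<exists>M. \<forall>A. ?small M A \<longrightarrow> _")
proof (rule ccontr)
  assume "\<not> ?thesis"
  then have "\<exists>A p q. ?small M A \<and> p \<in> A \<and> q \<in> A \<and> dist p q \<ge> \<delta>" for M
    unfolding not_ex not_all not_imp Ball_def not_less by (elim allE[of _ M] exE conjE) blast
  then have "\<forall>M. \<exists>A p q. ?small M A \<and> p \<in> A \<and> q \<in> A \<and> dist p q \<ge> \<delta>" ..
  from choice[OF this] obtain A0 where "\<forall>M. \<exists>p q. ?small M (A0 M) \<and> p \<in> A0 M \<and> q \<in> A0 M \<and> dist p q \<ge> \<delta>" ..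
  from choice[OF this] obtain p0 where "\<forall>M. \<exists>q. ?small M (A0 M) \<and> p0 M \<in> A0 M \<and> q \<in> A0 M \<and> dist (p0 M) q \<ge> \<delta>" ..
  from choice[OF this] obtain q0 where "\<forall>M. ?small M (A0 M) \<and> p0 M \<in> A0 M \<and> q0 M \<in> A0 M \<and> dist (p0 M) (q0 M) \<ge> \<delta>" ..
  then have A0: "\<And>M. A0 M \<subseteq> X" "\<And>M. connected (A0 M)" "\<And>M. p0 M \<in> A0 M" "\<And>M. q0 M \<in> A0 M"
    "\<And>M. dist (p0 M) (q0 M) \<ge> \<delta>"
    and A0_small: "\<And>M n p q. n \<in> icube M \<Longrightarrow> p \<in> A0 M \<Longrightarrow> q \<in> A0 M \<Longrightarrow> dist (T n p) (T n q) \<le> c / 2"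
    by blast+
  have cX: "compact X" and cont: "\<And>n. continuous_on X (T n)"
    using act by (auto simp: Zk_action_def)
  have "compact (X \<times> X)" using cX by (intro compact_Times)
  moreover have "\<forall>M. (p0 M, q0 M) \<in> X \<times> X" using subsetD[OF A0(1) A0(3)] subsetD[OF A0(1) A0(4)] by simp
  ultimately obtain xy r where xy: "xy \<in> X \<times> X" "strict_mono r" "((\<lambda>M. (p0 M, q0 M)) \<circ> r) \<longlonglongrightarrow> xy"
    by (rule seq_compactE[OF compact_imp_seq_compact])
  obtain x y where "xy = (x, y)" by fastforce
  then have x: "x \<in> X" "(\<lambda>j. p0 (r j)) \<longlonglongrightarrow> x" and y: "y \<in> X" "(\<lambda>j. q0 (r j)) \<longlonglongrightarrow> y"
    using xy(1) tendsto_fst[OF xy(3)] tendsto_snd[OF xy(3)] by (auto simp: o_def)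
  define A where "A = (\<lambda>j. A0 (r j))"
  define L where "L = (\<Inter>j. closure (\<Union>i\<in>{j..}. A i))"
  have "connected L"
    unfolding L_def A_def using cX A0(1,2,3) x(2) by (rule connected_upper_limit)
  have "L \<subseteq> X"
  proof -
    have "L \<subseteq> closure (\<Union>i\<in>{0..}. A i)" unfolding L_def by blast
    also have "\<dots> \<subseteq> X" using cX A0(1) by (intro closure_minimal) (auto simp: A_def compact_imp_closed)
    finally show ?thesis .
  qed
  have lim_in: "z \<in> L" if "\<And>i. s i \<in> A i" "s \<longlonglongrightarrow> z" for s z
    unfolding L_def
  proof
    fix j
    show "z \<in> closure (\<Union>i\<in>{j..}. A i)"
      using that(2) by (rule LIMSEQ_in_closure[where j = j]) (use that(1) in blast)
  qed
  have "x \<in> L" "y \<in> L" using lim_in[OF _ x(2)] lim_in[OF _ y(2)] A0(3,4) by (simp_all add: A_def)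
  have "dist x y \<ge> \<delta>"
    using tendsto_dist[OF x(2) y(2)] A0(5) by (intro tendsto_lowerbound) auto
  then have "x \<noteq> y" using \<open>\<delta> > 0\<close> by auto
  have "closed L" unfolding L_def by auto
  obtain n where n: "diameter (T n ` L) > c"
    using cw[OF \<open>L \<subseteq> X\<close> _ \<open>connected L\<close> \<open>closed L\<close>] \<open>x \<in> L\<close> \<open>y \<in> L\<close> \<open>x \<noteq> y\<close> by blast
  \<comment> \<open>Two points of \<open>L\<close> may be limits along different subsequences, so
    they are not compared directly. Each is compared with \<open>x\<close>, the limit of the whole
    sequence \<open>p0 (r j)\<close>; this doubles the constant and explains \<open>c / 2\<close> in
    the statement.\<close>
  have near: "dist (T n z) (T n x) \<le> c / 2" if z: "z \<in> L" for z
  proof (rule field_le_epsilon)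
    fix e :: real assume "e > 0"
    have zX: "z \<in> X" using z \<open>L \<subseteq> X\<close> by blast
    obtain d where d: "d > 0" "\<And>w. w \<in> X \<Longrightarrow> dist w z < d \<Longrightarrow> dist (T n w) (T n z) < e / 2"
      using cont[of n] zX \<open>e > 0\<close> unfolding continuous_on_iff by (metis half_gt_zero)
    have "(\<lambda>j. T n (p0 (r j))) \<longlonglongrightarrow> T n x"
      using cont[of n] x(2) x(1) by (rule continuous_on_tendsto_compose) (use subsetD[OF A0(1) A0(3)] in simp)
    then have "\<forall>\<^sub>F j in sequentially. dist (T n (p0 (r j))) (T n x) < e / 2"
      using \<open>e > 0\<close> by (intro tendstoD) auto
    then obtain j0 where j0: "\<And>j. j \<ge> j0 \<Longrightarrow> dist (T n (p0 (r j))) (T n x) < e / 2"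
      by (auto simp: eventually_sequentially)
    obtain N where N: "n \<in> icube N" using ex_in_icube by blast
    \<comment> \<open>The index is taken so large that \<open>T n (p0 (r i))\<close> is near
      \<open>T n x\<close> and that \<open>n\<close> lies in \<open>icube (r i)\<close>, where
      \<open>A0 (r i)\<close> is known to be small.\<close>
    have "z \<in> closure (\<Union>i\<in>{max j0 N..}. A i)" using z by (auto simp: L_def)
    then obtain w where w: "w \<in> (\<Union>i\<in>{max j0 N..}. A i)" "dist w z < d"
      using d(1) closure_approachable by blast
    then obtain i where i: "i \<ge> j0" "i \<ge> N" "w \<in> A0 (r i)" by (auto simp: A_def)
    have "n \<in> icube (r i)"
      using N icube_mono[of N "r i"] i(2) seq_suble[OF xy(2), of i] by (meson le_trans subsetD)
    then have "dist (T n w) (T n (p0 (r i))) \<le> c / 2" using i(3) A0(3) by (rule A0_small)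
    moreover have "dist (T n w) (T n z) < e / 2" using d(2)[OF subsetD[OF A0(1) i(3)] w(2)] .
    moreover have "dist (T n (p0 (r i))) (T n x) < e / 2" using i(1) by (rule j0)
    moreover have "dist (T n z) (T n x) \<le> dist (T n w) (T n z) + dist (T n w) (T n (p0 (r i))) + dist (T n (p0 (r i))) (T n x)"
      using dist_triangle[of "T n z" "T n x" "T n w"] dist_triangle[of "T n w" "T n x" "T n (p0 (r i))"]
      by (simp add: dist_commute)
    ultimately show "dist (T n z) (T n x) \<le> c / 2 + e" by linarith
  qed
  have "diameter (T n ` L) \<le> c"
  proof -
    have "dist u v \<le> c" if "u \<in> T n ` L" "v \<in> T n ` L" for u v
    proof -
      have "dist u (T n x) \<le> c / 2" "dist v (T n x) \<le> c / 2" using near that by auto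
      then show ?thesis using dist_triangle2[of u v "T n x"] by linarith
    qed
    then show ?thesis
      unfolding diameter_def using \<open>c > 0\<close> by (auto intro!: cSUP_least)
  qed
  then show False using n by linarith
qed

text \<open>Boundary bumping yields a continuum \<open>C\<close> through \<open>x\<close> that stays
  within \<open>a\<close> of \<open>x\<close> at all times in \<open>icube R\<close> and attains
  distance \<open>a\<close> at some time \<open>m\<close>. Smallness along the shell excludes
  \<open>m\<close> from the shell. Otherwise every time in \<open>icube M\<close> added to
  \<open>m\<close> stays in \<open>icube R\<close>, so \<open>uni\<close> applies to
  \<open>T m\<close> followed by \<open>C\<close> as an image and forces a distance below
  \<open>a\<close>.\<close>

lemma shell_control:
  fixes X :: "'a::metric_space set" and T :: "int^'n \<Rightarrow> 'a \<Rightarrow> 'a"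
  assumes act: "Zk_action X T" and "a > 0"
    and uni: "\<And>A p q. A \<subseteq> X \<Longrightarrow> connected A \<Longrightarrow>
       (\<And>n u v. n \<in> icube M \<Longrightarrow> u \<in> A \<Longrightarrow> v \<in> A \<Longrightarrow> dist (T n u) (T n v) \<le> 2 * a) \<Longrightarrow>
       p \<in> A \<Longrightarrow> q \<in> A \<Longrightarrow> dist p q < a"
    and A: "A \<subseteq> X" "connected A" "closed A" and "M \<le> R"
    and shell: "\<And>n p q. n \<in> icube R - icube (R - M) \<Longrightarrow> p \<in> A \<Longrightarrow> q \<in> A \<Longrightarrow> dist (T n p) (T n q) < a"
    and n: "n \<in> icube R" "p \<in> A" "x \<in> A"
  shows "dist (T n p) (T n x) \<le> a"
proof (rule ccontr)
  assume neg: "\<not> ?thesis"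
  have "compact X" and cont: "\<And>n. continuous_on X (T n)" and TX: "\<And>n. T n ` X \<subseteq> X"
    and T_add: "\<And>m n x. x \<in> X \<Longrightarrow> T (m + n) x = T m (T n x)"
    using act by (auto simp: Zk_action_def)
  have cA: "compact A" using A(1,3) \<open>compact X\<close> by (metis compact_Int_closed inf.absorb_iff2)
  have contA: "continuous_on A (\<lambda>p. dist (T n p) (T n x))" for n
    using continuous_on_subset[OF cont A(1)] by (intro continuous_intros)
  define S where "S = {p\<in>A. \<forall>n\<in>icube R. dist (T n p) (T n x) \<le> a}"
  define O' where "O' = {p\<in>A. \<forall>n\<in>icube R. dist (T n p) (T n x) < a}"
  have S_eq: "S = A \<inter> (\<Inter>n\<in>icube R. A \<inter> (\<lambda>p. dist (T n p) (T n x)) -` {..a})"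
    by (auto simp: S_def)
  have "closedin (top_of_set A) S"
  proof -
    have "icube R \<noteq> ({} :: (int^'n) set)" using zero_in_icube by blast
    moreover have "closedin (top_of_set A) (A \<inter> (\<lambda>p. dist (T n p) (T n x)) -` {..a})" for n
      using contA by (intro continuous_closedin_preimage) auto
    ultimately have "closedin (top_of_set A) (\<Inter>n\<in>icube R. A \<inter> (\<lambda>p. dist (T n p) (T n x)) -` {..a})"
      by (rule closedin_INT)
    then show ?thesis unfolding S_eq by (intro closedin_Int closedin_self)
  qed
  have "openin (top_of_set A) O'"
  proof -
    have "openin (top_of_set A) (A \<inter> (\<lambda>p. dist (T n p) (T n x)) -` {..<a})" for n
      using contA by (intro continuous_openin_preimage_gen) auto
    then have "openin (top_of_set A) ((\<Inter>n\<in>icube R. A \<inter> (\<lambda>p. dist (T n p) (T n x)) -` {..<a}) \<inter> topspace (top_of_set A))"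
      using finite_icube by (intro openin_INT) auto
    moreover have "(\<Inter>n\<in>icube R. A \<inter> (\<lambda>p. dist (T n p) (T n x)) -` {..<a}) \<inter> topspace (top_of_set A) = O'"
      by (auto simp: O'_def)
    ultimately show ?thesis by simp
  qed
  \<comment> \<open>This is the only use of the negated claim: \<open>p\<close> lies outside
    \<open>S\<close>, so \<open>S\<close> is a proper closed subset and its components must reach
    its frontier.\<close>
  have "S \<noteq> A" using neg n by (auto simp: S_def)
  have "x \<in> S" using n \<open>a > 0\<close> by (simp add: S_def)
  have "S \<subseteq> A" "O' \<subseteq> S" by (auto simp: S_def O'_def)
  define C where "C = connected_component_set S x"
  have "C \<inter> (top_of_set A) frontier_of S \<noteq> {}"
  proof (rule boundary_bumping_theorem_closed)
    have "subtopology (top_of_set A) S = top_of_set S"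
      using \<open>S \<subseteq> A\<close> by (simp add: subtopology_subtopology inf.absorb2)
    then show "C \<in> connected_components_of (subtopology (top_of_set A) S)"
      using connected_component_in_connected_components_of[of "top_of_set S" x] \<open>x \<in> S\<close>
      by (simp add: C_def connected_component_of_set_top)
  qed (use A cA \<open>S \<noteq> A\<close> \<open>closedin (top_of_set A) S\<close> in
        \<open>auto simp: compact_space_subtopology Hausdorff_space_subtopology connected_space_subconnected\<close>)
  then obtain b where b: "b \<in> C" "b \<in> (top_of_set A) frontier_of S" by blast
  \<comment> \<open>\<open>O'\<close> is open and contained in \<open>S\<close>, hence in the
    interior of \<open>S\<close>, which a frontier point avoids.\<close>
  have "b \<notin> O'"
    using b(2) interior_of_maximal[OF \<open>O' \<subseteq> S\<close> \<open>openin (top_of_set A) O'\<close>] by (auto simp: frontier_of_def)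
  have CS: "C \<subseteq> S" unfolding C_def by (rule connected_component_subset)
  then have CX: "C \<subseteq> X" using \<open>S \<subseteq> A\<close> A by blast
  have "connected C" "x \<in> C" using \<open>x \<in> S\<close> by (auto simp: C_def)
  obtain m where m: "m \<in> icube R" "dist (T m b) (T m x) \<ge> a"
    using \<open>b \<notin> O'\<close> b(1) CS \<open>S \<subseteq> A\<close> by (auto simp: O'_def not_less)
  have bd: "dist (T k u) (T k v) \<le> 2 * a" if "k \<in> icube R" "u \<in> C" "v \<in> C" for k u v
  proof -
    have "dist (T k u) (T k x) \<le> a" "dist (T k v) (T k x) \<le> a" using that CS by (auto simp: S_def)
    then show ?thesis using dist_triangle2[of "T k u" "T k v" "T k x"] by linarith
  qed
  show False
  proof (cases "m \<in> icube (R - M)")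
    case False
    then have "dist (T m b) (T m x) < a" using m(1) b(1) CS \<open>S \<subseteq> A\<close> n(3) by (intro shell) auto
    then show False using m(2) by linarith
  next
    case True
    have "dist (T m b) (T m x) < a"
    proof (rule uni[of "T m ` C"])
      show "T m ` C \<subseteq> X" using TX CX by blast
      show "connected (T m ` C)"
        using \<open>connected C\<close> continuous_on_subset[OF cont CX] by (rule connected_continuous_image[rotated])
      fix k :: "int^'n" and u v assume k: "k \<in> icube M" and "u \<in> T m ` C" "v \<in> T m ` C"
      then obtain u' v' where uv: "u = T m u'" "v = T m v'" "u' \<in> C" "v' \<in> C" by blast
      have "k + m \<in> icube R" using icube_add[OF k True] \<open>M \<le> R\<close> by simp
      then have "dist (T (k + m) u') (T (k + m) v') \<le> 2 * a" using bd uv by blast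
      then show "dist (T k u) (T k v) \<le> 2 * a" using uv CX T_add by (simp add: subset_iff)
    qed (use b(1) \<open>x \<in> C\<close> in auto)
    then show False using m(2) by linarith
  qed
qed

section \<open>Counting lattice points and volumes of sections\<close>

text \<open>The shell count is a difference of two powers with exponent \<open>CARD('n)\<close>, so
  it loses one degree. This is the source of the growth of degree \<open>CARD('n) - 1\<close> in the
  final estimate.\<close>

lemma card_icube_shell_le:
  assumes "M \<le> R"
  shows "card (icube R - icube (R - M) :: (int^'n) set) \<le> 2 * M * CARD('n) * (2 * R + 1) ^ (CARD('n) - 1)"
proof -
  \<comment> \<open>A mean value bound for powers, kept in the natural numbers. At
    \<open>k = 0\<close> the truncated \<open>k - 1\<close> is harmless because of the factor
    \<open>k\<close>.\<close>
  have pow: "(b + d) ^ k \<le> b ^ k + d * k * (b + d) ^ (k - 1)" for b d k :: nat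
  proof (induction k)
    case (Suc k)
    have "(b + d) ^ Suc k \<le> (b + d) * (b ^ k + d * k * (b + d) ^ (k - 1))"
      using mult_left_mono[OF Suc, of "b + d"] by simp
    also have "\<dots> = b ^ Suc k + d * b ^ k + d * k * ((b + d) * (b + d) ^ (k - 1))"
      by (simp add: algebra_simps)
    also have "d * k * ((b + d) * (b + d) ^ (k - 1)) = d * k * (b + d) ^ k"
      by (cases k) auto
    also have "d * b ^ k \<le> d * (b + d) ^ k"
      by (intro mult_left_mono power_mono) auto
    finally show ?case by (simp add: algebra_simps)
  qed simp
  have "card (icube R - icube (R - M) :: (int^'n) set) = (2 * R + 1) ^ CARD('n) - (2 * (R - M) + 1) ^ CARD('n)"
    by (simp only: card_Diff_subset[OF finite_icube icube_mono[OF diff_le_self]] card_icube)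
  also have "\<dots> \<le> 2 * M * CARD('n) * (2 * R + 1) ^ (CARD('n) - 1)"
  proof -
    have "2 * R + 1 = (2 * (R - M) + 1) + 2 * M" using assms by simp
    then have "(2 * R + 1) ^ CARD('n) \<le> (2 * (R - M) + 1) ^ CARD('n) + 2 * M * CARD('n) * (2 * R + 1) ^ (CARD('n) - 1)"
      using pow[of "2 * (R - M) + 1" "2 * M" "CARD('n)"] by (simp only:)
    then show ?thesis by (simp only: le_diff_conv2 le_diff_conv add.commute)
  qed
  finally show ?thesis .
qed

lemma onb_orthonormal:
  fixes V :: "(real^'n) set"
  assumes "subspace V"
  shows "\<And>i. i < dim V \<Longrightarrow> onb V i \<in> V"
    and "\<And>i j. i < dim V \<Longrightarrow> j < dim V \<Longrightarrow> onb V i \<bullet> onb V j = (if i = j then 1 else 0)"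
proof -
  obtain B where B: "B \<subseteq> V" "pairwise orthogonal B" "\<And>x. x \<in> B \<Longrightarrow> norm x = 1"
    "independent B" "card B = dim V"
    by (rule orthonormal_basis_subspace[OF assms]) (rule that)
  obtain b where b: "bij_betw b {..<dim V} B"
    using ex_bij_betw_nat_finite[OF independent_imp_finite[OF B(4)]] B(5) by (auto simp: lessThan_atLeast0)
  have "b i \<bullet> b j = (if i = j then 1 else 0)" if "i < dim V" "j < dim V" for i j
  proof (cases "i = j")
    case True
    have "b i \<in> B" using b that by (auto simp: bij_betw_def)
    then show ?thesis using B(3) True by (simp add: norm_eq_1)
  next
    case False
    then have "b i \<noteq> b j" "b i \<in> B" "b j \<in> B" using b that by (auto simp: bij_betw_def inj_on_def)
    then show ?thesis using B(2) False by (auto simp: pairwise_def orthogonal_def)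
  qed
  moreover have "b i \<in> V" if "i < dim V" for i using b that B(1) by (auto simp: bij_betw_def)
  ultimately have "(\<forall>i<dim V. b i \<in> V) \<and>
       (\<forall>i<dim V. \<forall>j<dim V. b i \<bullet> b j = (if i = j then 1 else 0))" by blast
  from someI[where P = "\<lambda>b. (\<forall>i<dim V. b i \<in> V) \<and>
       (\<forall>i<dim V. \<forall>j<dim V. b i \<bullet> b j = (if i = j then 1 else 0))", OF this]
  have o: "(\<forall>i<dim V. onb V i \<in> V) \<and>
       (\<forall>i<dim V. \<forall>j<dim V. onb V i \<bullet> onb V j = (if i = j then 1 else 0))"
    unfolding onb_def .
  show "\<And>i. i < dim V \<Longrightarrow> onb V i \<in> V" using o by blast
  show "\<And>i j. i < dim V \<Longrightarrow> j < dim V \<Longrightarrow> onb V i \<bullet> onb V j = (if i = j then 1 else 0)"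
    using o by blast
qed

lemma emeasure_PiM_lborel_box:
  fixes a b :: real
  assumes "a \<le> b"
  shows "emeasure (PiM {..<h::nat} (\<lambda>_. lborel)) (\<Pi>\<^sub>E i\<in>{..<h}. {a..b}) = ennreal ((b - a) ^ h)"
proof -
  interpret product_sigma_finite "\<lambda>_::nat. lborel :: real measure" by standard
  show ?thesis
    using assms by (subst emeasure_PiM) (auto simp: prod_constant ennreal_power)
qed

text \<open>At most \<open>CARD('n)\<close> orthonormal vectors are combined, so coefficients
  bounded by \<open>N / CARD('n)\<close> give a vector of norm at most \<open>N\<close>, which lies
  in the cube. The section thus contains the image of a box of known volume.\<close>

lemma vol_sub_cube_ge:
  fixes V :: "(real^'n) set"
  assumes V: "subspace V"
  shows "vol_sub V (V \<inter> rcube N) \<ge> (2 * real N / real CARD('n)) ^ dim V"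
proof -
  define h where "h = dim V"
  define b where "b = onb V"
  define \<mu> where "\<mu> = PiM {..<h} (\<lambda>_. lborel :: real measure)"
  define \<Phi> where "\<Phi> = (\<lambda>x::nat \<Rightarrow> real. \<Sum>i<h. x i *\<^sub>R b i)"
  define E where "E = {x \<in> space \<mu>. \<Phi> x \<in> V \<inter> rcube N}"
  let ?k = "real CARD('n)"
  let ?a = "real N / ?k" and ?c = "?k * real N"
  have k: "?k \<ge> 1" by (simp add: Suc_leI)
  have hk: "real h \<le> ?k" unfolding h_def using dim_subset_UNIV[of V] by simp
  have bV: "b i \<in> V" if "i < h" for i using onb_orthonormal(1)[OF V] that by (simp add: b_def h_def)
  have orth: "b i \<bullet> b j = (if i = j then 1 else 0)" if "i < h" "j < h" for i j
    using onb_orthonormal(2)[OF V] that by (simp add: b_def h_def)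
  have nb: "norm (b i) = 1" if "i < h" for i using orth[OF that that] by (simp add: norm_eq_1)
  have \<Phi>V: "\<Phi> x \<in> V" for x unfolding \<Phi>_def using V bV by (intro subspace_sum subspace_mul) auto
  have space: "space \<mu> = (\<Pi>\<^sub>E i\<in>{..<h}. UNIV)" by (simp add: \<mu>_def space_PiM)
  have lower: "(\<Pi>\<^sub>E i\<in>{..<h}. {- ?a..?a}) \<subseteq> E"
  proof
    fix x assume x: "x \<in> (\<Pi>\<^sub>E i\<in>{..<h}. {- ?a..?a})"
    have "norm (\<Phi> x) \<le> (\<Sum>i<h. norm (x i *\<^sub>R b i))" unfolding \<Phi>_def by (rule norm_sum)
    also have "\<dots> \<le> (\<Sum>i<h. ?a)"
      using x nb by (intro sum_mono) (auto simp: PiE_iff abs_le_iff minus_le_iff)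
    also have "\<dots> \<le> ?k * ?a" using mult_right_mono[OF hk, of ?a] by simp
    also have "\<dots> = real N" using k by simp
    finally have "\<bar>\<Phi> x $ i\<bar> \<le> real N" for i using component_le_norm_cart[of "\<Phi> x" i] by linarith
    then have "\<Phi> x \<in> rcube N" by (simp add: rcube_def)
    moreover have "x \<in> space \<mu>" using x by (auto simp: space PiE_iff)
    ultimately show "x \<in> E" using \<Phi>V by (simp add: E_def)
  qed
  \<comment> \<open>\<open>measure\<close> is 0 on sets of infinite measure, so monotonicity
    requires \<open>E\<close> to have finite measure; a larger box containing \<open>E\<close>
    provides this.\<close>
  have upper: "E \<subseteq> (\<Pi>\<^sub>E i\<in>{..<h}. {- ?c..?c})"
  proof
    fix x assume x: "x \<in> E"
    have "norm (\<Phi> x) \<le> (\<Sum>i\<in>UNIV. \<bar>\<Phi> x $ i\<bar>)" by (rule norm_le_l1_cart)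
    also have "\<dots> \<le> (\<Sum>i\<in>(UNIV::'n set). real N)" using x by (intro sum_mono) (auto simp: E_def rcube_def)
    also have "\<dots> = ?c" by simp
    finally have n: "norm (\<Phi> x) \<le> ?c" .
    have "\<bar>x j\<bar> \<le> ?c" if "j < h" for j
    proof -
      have "\<Phi> x \<bullet> b j = (\<Sum>i<h. if i = j then x i else 0)"
        unfolding \<Phi>_def inner_sum_left using orth that by (intro sum.cong) auto
      also have "\<dots> = x j" using that by (simp add: sum.delta)
      finally have "\<bar>x j\<bar> \<le> norm (\<Phi> x) * norm (b j)" using Cauchy_Schwarz_ineq2[of "\<Phi> x" "b j"] by simp
      then show ?thesis using nb[OF that] n by simp
    qed
    then show "x \<in> (\<Pi>\<^sub>E i\<in>{..<h}. {- ?c..?c})"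
      using x by (auto simp: E_def space PiE_iff abs_le_iff minus_le_iff)
  qed
  have box: "(\<Pi>\<^sub>E i\<in>{..<h}. {- d..d}) \<in> fmeasurable \<mu>"
    "measure \<mu> (\<Pi>\<^sub>E i\<in>{..<h}. {- d..d}) = (2 * d) ^ h" if "d \<ge> 0" for d :: real
  proof -
    have e: "emeasure \<mu> (\<Pi>\<^sub>E i\<in>{..<h}. {- d..d}) = ennreal ((2 * d) ^ h)"
      using emeasure_PiM_lborel_box[of "- d" d h] that by (simp add: \<mu>_def)
    moreover have "(\<Pi>\<^sub>E i\<in>{..<h}. {- d..d}) \<in> sets \<mu>"
      unfolding \<mu>_def by (intro sets_PiM_I_finite) auto
    ultimately show "(\<Pi>\<^sub>E i\<in>{..<h}. {- d..d}) \<in> fmeasurable \<mu>" by (intro fmeasurableI) auto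
    show "measure \<mu> (\<Pi>\<^sub>E i\<in>{..<h}. {- d..d}) = (2 * d) ^ h"
      using e that by (simp add: measure_def)
  qed
  have "E \<in> sets \<mu>"
  proof -
    have "\<Phi> \<in> borel_measurable \<mu>"
      unfolding \<Phi>_def \<mu>_def by (intro borel_measurable_sum borel_measurable_scaleR) auto
    moreover have "closed (V \<inter> rcube N)"
    proof (rule closed_Int)
      show "closed V" using V by (rule closed_subspace)
      have "rcube N = (\<Inter>i. {x::real^'n. \<bar>x $ i\<bar> \<le> real N})" by (auto simp: rcube_def)
      also have "closed \<dots>" by (intro closed_INT ballI closed_Collect_le continuous_intros)
      finally show "closed (rcube N :: (real^'n) set)" .
    qed
    ultimately have "\<Phi> -` (V \<inter> rcube N) \<inter> space \<mu> \<in> sets \<mu>" by (intro measurable_sets) auto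
    moreover have "\<Phi> -` (V \<inter> rcube N) \<inter> space \<mu> = E" by (auto simp: E_def)
    ultimately show ?thesis by simp
  qed
  then have "E \<in> fmeasurable \<mu>" using box(1)[of ?c] upper by (intro fmeasurableI2[of _ \<mu> E]) auto
  then have "measure \<mu> (\<Pi>\<^sub>E i\<in>{..<h}. {- ?a..?a}) \<le> measure \<mu> E"
    using lower box(1)[of ?a] by (intro measure_mono_fmeasurable) (auto dest: fmeasurableD)
  then have "(2 * ?a) ^ h \<le> measure \<mu> E" using box(2)[of ?a] by simp
  moreover have "vol_sub V (V \<inter> rcube N) = measure \<mu> E"
    by (simp add: vol_sub_def E_def \<mu>_def \<Phi>_def h_def b_def)
  ultimately show ?thesis by (simp add: h_def)
qed

text \<open>A bound on values passes to \<open>Lim\<close> only once convergence is known. An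
  antitone function converges, as its argument decreases to 0, to its supremum over the positive
  reals.\<close>

lemma Lim_at_right_antimono_le:
  fixes f :: "real \<Rightarrow> ereal"
  assumes anti: "\<And>x y. 0 < x \<Longrightarrow> x \<le> y \<Longrightarrow> f y \<le> f x" and le: "\<And>x. x > 0 \<Longrightarrow> f x \<le> C"
  shows "Lim (at_right 0) f \<le> C"
proof -
  define L where "L = (SUP x\<in>{0<..}. f x)"
  have "(f \<longlongrightarrow> L) (at_right 0)"
  proof (rule order_tendstoI)
    fix a assume "a < L"
    then obtain x where x: "x > 0" "a < f x" unfolding L_def less_SUP_iff by auto
    then have "a < f y" if "0 < y" "y < x" for y using anti[of y x] that by (auto intro: less_le_trans)
    then show "\<forall>\<^sub>F y in at_right 0. a < f y"
      using x(1) unfolding eventually_at_right_field by blast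
  next
    fix a assume "L < a"
    then have "f x < a" if "x > 0" for x
      using that SUP_upper[of x "{0<..}" f] unfolding L_def by (auto intro: le_less_trans)
    then show "\<forall>\<^sub>F y in at_right 0. f y < a"
      unfolding eventually_at_right_field using zero_less_one by blast
  qed
  then have "Lim (at_right 0) f = L" by (intro tendsto_Lim) auto
  also have "L \<le> C" unfolding L_def using le by (intro SUP_least) auto
  finally show ?thesis .
qed

lemma Widim_eps_antimono:
  fixes X :: "'a::metric_space set"
  shows "x \<le> y \<Longrightarrow> Widim_eps y X \<rho> \<le> Widim_eps x X \<rho>"
  unfolding Widim_eps_def
proof (rule Inf_superset_mono, rule subsetI)
  fix d assume "x \<le> y" and "d \<in> {cov_dim K | (K::'a topology) f. compact_space K \<and> metrizable_space K \<and>
       continuous_map (top_of_set X) K f \<and> (\<forall>p\<in>X. \<forall>q\<in>X. f p = f q \<longrightarrow> \<rho> p q < x)}"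
  then obtain K :: "'a topology" and f where "d = cov_dim K" "compact_space K" "metrizable_space K"
    "continuous_map (top_of_set X) K f" "\<forall>p\<in>X. \<forall>q\<in>X. f p = f q \<longrightarrow> \<rho> p q < x" by blast
  moreover from this(5) \<open>x \<le> y\<close> have "\<forall>p\<in>X. \<forall>q\<in>X. f p = f q \<longrightarrow> \<rho> p q < y"
    by (meson less_le_trans)
  ultimately show "d \<in> {cov_dim K | (K::'a topology) f. compact_space K \<and> metrizable_space K \<and>
       continuous_map (top_of_set X) K f \<and> (\<forall>p\<in>X. \<forall>q\<in>X. f p = f q \<longrightarrow> \<rho> p q < y)}" by blast
qed

section \<open>The mean dimension bound\<close>

text \<open>Each set \<open>V\<close> of the grid cover is enclosed in a compact set
  \<open>P\<close> on which the coordinates \<open>g i\<close> still vary little. The components of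
  \<open>P\<close> are small by assumption, so \<open>P\<close> splits into small clopen pieces.
  Cutting \<open>V\<close> along these disjoint pieces makes it small without raising the order of
  the cover.\<close>

lemma Widim_eps_of_connected_small:
  fixes X :: "'a::metric_space set" and T :: "int^'n \<Rightarrow> 'a \<Rightarrow> 'a" and g :: "'i \<Rightarrow> 'a \<Rightarrow> real"
  assumes "compact X" and cont: "\<And>n. continuous_on X (T n)" and "finite I"
    and contg: "\<And>i. i \<in> I \<Longrightarrow> continuous_on X (g i)" and "s > 0" and \<Omega>: "finite \<Omega>" "\<Omega> \<noteq> {}" and "eps > 0"
    and small: "\<And>A n p q. A \<subseteq> X \<Longrightarrow> connected A \<Longrightarrow> closed A \<Longrightarrow>
      (\<And>i u v. i \<in> I \<Longrightarrow> u \<in> A \<Longrightarrow> v \<in> A \<Longrightarrow> \<bar>g i u - g i v\<bar> \<le> 2 * s) \<Longrightarrow>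
      n \<in> \<Omega> \<Longrightarrow> p \<in> A \<Longrightarrow> q \<in> A \<Longrightarrow> dist (T n p) (T n q) < eps / 2"
  shows "Widim_eps eps X (dT T \<Omega>) \<le> enat (card I + 1)"
proof -
  \<comment> \<open>Here all coordinates may be nonzero, so the grid cover has order
    \<open>card I + 1\<close>.\<close>
  have sparse: "card {i\<in>I. g i x \<noteq> 0} \<le> card I" for x
    using \<open>finite I\<close> by (intro card_mono) auto
  obtain \<V> where V: "finite \<V>" "\<And>V. V \<in> \<V> \<Longrightarrow> openin (top_of_set X) V" "X \<subseteq> \<Union>\<V>"
    "\<And>x. x \<in> X \<Longrightarrow> card {V\<in>\<V>. x \<in> V} \<le> card I + 1"
    "\<And>V p q i. V \<in> \<V> \<Longrightarrow> p \<in> V \<Longrightarrow> q \<in> V \<Longrightarrow> i \<in> I \<Longrightarrow> \<bar>g i p - g i q\<bar> \<le> s"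
    by (rule grid_cover[OF \<open>compact X\<close> \<open>finite I\<close> contg sparse \<open>s > 0\<close>]) (assumption, rule that)
  define Q where "Q = (\<lambda>H. \<forall>p\<in>H. \<forall>q\<in>H. \<forall>n\<in>\<Omega>. dist (T n p) (T n q) < eps)"
  have "\<exists>\<H>. finite \<H> \<and> disjoint \<H> \<and> V \<subseteq> \<Union>\<H> \<and> (\<forall>H\<in>\<H>. openin (top_of_set X) (V \<inter> H) \<and> Q H)"
    if Vin: "V \<in> \<V>" for V
  proof (cases "V = {}")
    case True
    then show ?thesis by (intro exI[of _ "{}"]) (auto simp: disjoint_def)
  next
    case False
    then obtain v where v: "v \<in> V" by blast
    have VX: "V \<subseteq> X" using V(2)[OF Vin] by (rule openin_imp_subset)
    \<comment> \<open>\<open>V\<close> is only open, whereas the clopen partition needs a compact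
      set. \<open>P\<close> is closed, contains \<open>V\<close>, and its points are compared
      through \<open>v\<close>, whence \<open>2 * s\<close>. The leading \<open>X\<close> keeps
      \<open>P\<close> inside \<open>X\<close> when \<open>I\<close> is empty.\<close>
    define P where "P = X \<inter> (\<Inter>(i, q)\<in>I \<times> V. X \<inter> (\<lambda>p. \<bar>g i p - g i q\<bar>) -` {..s})"
    have P_iff: "p \<in> P \<longleftrightarrow> p \<in> X \<and> (\<forall>i\<in>I. \<forall>q\<in>V. \<bar>g i p - g i q\<bar> \<le> s)" for p
      by (auto simp: P_def)
    have "closedin (top_of_set X) P"
    proof (cases "I = {}")
      case True
      then show ?thesis by (simp add: P_def)
    next
      case False
      have "closedin (top_of_set X) (X \<inter> (\<lambda>p. \<bar>g i p - g i q\<bar>) -` {..s})" if "i \<in> I" for i q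
        using contg[OF that] by (intro continuous_closedin_preimage continuous_intros) auto
      then show ?thesis
        unfolding P_def using False v by (intro closedin_Int closedin_self closedin_INT) auto
    qed
    then have "compact P" and PX: "P \<subseteq> X"
      using \<open>compact X\<close> closedin_compact closedin_imp_subset by blast+
    have VP: "V \<subseteq> P" using V(5)[OF Vin] VX by (auto simp: P_iff)
    have Pg: "\<bar>g i p - g i q\<bar> \<le> 2 * s" if "i \<in> I" "p \<in> P" "q \<in> P" for i p q
    proof -
      have "\<bar>g i p - g i v\<bar> \<le> s" "\<bar>g i q - g i v\<bar> \<le> s" using that v by (auto simp: P_iff)
      then show ?thesis by linarith
    qed
    have ex: "\<exists>H. openin (top_of_set P) H \<and> closedin (top_of_set P) H \<and> x \<in> H \<and> Q H" if x: "x \<in> P" for x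
    proof -
      define U where "U = (\<Inter>n\<in>\<Omega>. P \<inter> (\<lambda>q. dist (T n x) (T n q)) -` {..<eps / 2}) \<inter> topspace (top_of_set P)"
      have "openin (top_of_set P) (P \<inter> (\<lambda>q. dist (T n x) (T n q)) -` {..<eps / 2})" for n
        using continuous_on_subset[OF cont PX] by (intro continuous_openin_preimage_gen continuous_intros) auto
      then have U: "openin (top_of_set P) U"
        unfolding U_def using \<Omega>(1) by (intro openin_INT) auto
      define C where "C = connected_component_set P x"
      have CP: "C \<subseteq> P" unfolding C_def by (rule connected_component_subset)
      have "compact C"
        unfolding C_def using \<open>compact P\<close> x closedin_connected_component closedin_compact by blast
      have Csmall: "dist (T n x) (T n q) < eps / 2" if "n \<in> \<Omega>" "q \<in> C" for n q
      proof (rule small[of C])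
        show "C \<subseteq> X" using CP PX by blast
        show "connected C" "x \<in> C" using x by (auto simp: C_def)
        show "closed C" using \<open>compact C\<close> by (rule compact_imp_closed)
        show "\<bar>g i u - g i w\<bar> \<le> 2 * s" if "i \<in> I" "u \<in> C" "w \<in> C" for i u w
          using that CP by (intro Pg) auto
      qed (use that in auto)
      have "C \<subseteq> U" unfolding U_def using Csmall CP by auto
      then obtain H where H: "openin (top_of_set P) H" "closedin (top_of_set P) H" "x \<in> H" "H \<subseteq> U"
        using compact_component_clopen_nbhd[OF \<open>compact P\<close> x U] unfolding C_def by blast
      have "dist (T n p) (T n q) < eps" if "p \<in> H" "q \<in> H" "n \<in> \<Omega>" for p q n
      proof -
        have "dist (T n x) (T n p) < eps / 2" "dist (T n x) (T n q) < eps / 2"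
          using that H(4) unfolding U_def by blast+
        then show ?thesis using dist_triangle3[of "T n p" "T n q" "T n x"] by linarith
      qed
      then show ?thesis using H by (auto simp: Q_def)
    qed
    have monoQ: "Q H'" if "Q H" "H' \<subseteq> H" for H H' using that unfolding Q_def by blast
    obtain \<H> where H: "finite \<H>" "disjoint \<H>" "\<Union>\<H> = P" "\<And>H. H \<in> \<H> \<Longrightarrow> openin (top_of_set P) H \<and> Q H"
      by (rule compact_clopen_partition[OF \<open>compact P\<close> ex monoQ]) (assumption+, rule that)
    \<comment> \<open>\<open>H\<close> is open only relative to \<open>P\<close>, but
      \<open>V\<close> is open in \<open>X\<close> and contained in \<open>P\<close>, so their
      intersection is open in \<open>X\<close>.\<close>
    have "openin (top_of_set X) (V \<inter> H)" if Hin: "H \<in> \<H>" for H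
    proof -
      obtain G where G: "open G" "H = P \<inter> G" using H(4)[OF Hin] by (auto simp: openin_open)
      then have "V \<inter> H = V \<inter> G" using VP by auto
      then show ?thesis using V(2)[OF Vin] G(1) by (simp add: openin_Int_open)
    qed
    then show ?thesis using H VP by (intro exI[of _ \<H>]) auto
  qed
  then have "\<forall>V\<in>\<V>. \<exists>\<H>. finite \<H> \<and> disjoint \<H> \<and> V \<subseteq> \<Union>\<H> \<and> (\<forall>H\<in>\<H>. openin (top_of_set X) (V \<inter> H) \<and> Q H)" ..
  from bchoice[OF this] obtain \<H> where
    "\<forall>V\<in>\<V>. finite (\<H> V) \<and> disjoint (\<H> V) \<and> V \<subseteq> \<Union>(\<H> V) \<and> (\<forall>H\<in>\<H> V. openin (top_of_set X) (V \<inter> H) \<and> Q H)" ..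
  then have H: "\<And>V. V \<in> \<V> \<Longrightarrow> finite (\<H> V)" "\<And>V. V \<in> \<V> \<Longrightarrow> disjoint (\<H> V)"
    "\<And>V. V \<in> \<V> \<Longrightarrow> V \<subseteq> \<Union>(\<H> V)" "\<And>V H. V \<in> \<V> \<Longrightarrow> H \<in> \<H> V \<Longrightarrow> openin (top_of_set X) (V \<inter> H)"
    "\<And>V H. V \<in> \<V> \<Longrightarrow> H \<in> \<H> V \<Longrightarrow> Q H"
    by simp_all
  define \<W> where "\<W> = (\<Union>V\<in>\<V>. (\<inter>) V ` \<H> V)"
  show ?thesis
  proof (rule Widim_eps_le[OF \<open>compact X\<close>, of \<W>])
    show "finite \<W>" unfolding \<W>_def using V(1) H(1) by blast
    show "openin (top_of_set X) W" if "W \<in> \<W>" for W using that H(4) by (auto simp: \<W>_def)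
    show "X \<subseteq> \<Union>\<W>"
    proof
      fix x assume "x \<in> X"
      then obtain V' where "V' \<in> \<V>" "x \<in> V'" using V(3) by blast
      moreover from this obtain H' where "H' \<in> \<H> V'" "x \<in> H'" using H(3) by blast
      ultimately show "x \<in> \<Union>\<W>" by (auto simp: \<W>_def)
    qed
    show "card {W\<in>\<W>. x \<in> W} \<le> card I + 1" if "x \<in> X" for x
    proof -
      \<comment> \<open>For each \<open>V\<close> containing \<open>x\<close>, disjointness leaves
        exactly one piece at \<open>x\<close>, so the new cover has no more members at
        \<open>x\<close> than the old one.\<close>
      have "{W\<in>\<W>. x \<in> W} \<subseteq> (\<lambda>V. V \<inter> (THE H. H \<in> \<H> V \<and> x \<in> H)) ` {V\<in>\<V>. x \<in> V}"
      proof
        fix W assume "W \<in> {W\<in>\<W>. x \<in> W}"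
        then obtain V' H' where W: "W = V' \<inter> H'" "V' \<in> \<V>" "H' \<in> \<H> V'" "x \<in> V'" "x \<in> H'"
          by (auto simp: \<W>_def)
        have "(THE H. H \<in> \<H> V' \<and> x \<in> H) = H'"
          using H(2)[OF W(2)] W by (intro the_equality) (auto simp: disjoint_def)
        then show "W \<in> (\<lambda>V. V \<inter> (THE H. H \<in> \<H> V \<and> x \<in> H)) ` {V\<in>\<V>. x \<in> V}"
          using W by (intro image_eqI[of _ _ V']) auto
      qed
      then have "card {W\<in>\<W>. x \<in> W} \<le> card ((\<lambda>V. V \<inter> (THE H. H \<in> \<H> V \<and> x \<in> H)) ` {V\<in>\<V>. x \<in> V})"
        using V(1) by (intro card_mono) auto
      also have "\<dots> \<le> card {V\<in>\<V>. x \<in> V}" using V(1) by (intro card_image_le) auto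
      also have "\<dots> \<le> card I + 1" using V(4) that by blast
      finally show ?thesis .
    qed
    show "dT T \<Omega> p q < eps" if W: "W \<in> \<W>" "p \<in> W" "q \<in> W" for W p q
    proof -
      obtain V' H' where V': "W = V' \<inter> H'" "V' \<in> \<V>" "H' \<in> \<H> V'" using W(1) by (auto simp: \<W>_def)
      then have "\<forall>n\<in>\<Omega>. dist (T n p) (T n q) < eps" using H(5)[OF V'(2,3)] W by (auto simp: Q_def)
      then show ?thesis unfolding dT_def using \<Omega> by (subst Max_less_iff) auto
    qed
  qed
qed

text \<open>\<open>B\<close> precedes \<open>eps\<close> because the thickness \<open>M0\<close> of
  the shell and the net \<open>Z\<close> depend on \<open>a\<close> alone. The scale
  \<open>eps\<close> only moves the shell outwards, to radius \<open>N + M\<close>, and this is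
  absorbed by taking \<open>N \<ge> M\<close>.\<close>

lemma cw_expansive_Widim_bound:
  fixes X :: "'a::metric_space set" and T :: "int^'n \<Rightarrow> 'a \<Rightarrow> 'a"
  assumes act: "Zk_action X T" and cw: "cw_expansive X T"
  obtains B :: nat where "\<And>eps. eps > 0 \<Longrightarrow> \<exists>M. \<forall>N\<ge>M. \<forall>\<Omega>. \<Omega> \<subseteq> icube N \<and> \<Omega> \<noteq> {} \<longrightarrow>
     Widim_eps eps X (dT T \<Omega>) \<le> enat (B * (4 * N + 1) ^ (CARD('n) - 1) + 1)"
proof -
  have "compact X" and cont: "\<And>n. continuous_on X (T n)" and TX: "\<And>n. T n ` X \<subseteq> X"
    and T_add: "\<And>m n x. x \<in> X \<Longrightarrow> T (m + n) x = T m (T n x)"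
    using act by (auto simp: Zk_action_def)
  obtain c where "c > 0" and cA: "\<forall>A. A \<subseteq> X \<and> A \<noteq> {} \<and> connected A \<and> closed A \<and> (\<exists>a\<in>A. \<exists>b\<in>A. a \<noteq> b)
      \<longrightarrow> (\<exists>n. diameter (T n ` A) > c)"
    using cw unfolding cw_expansive_def by (elim exE conjE)
  then have c: "c > 0" "\<And>A. A \<subseteq> X \<Longrightarrow> A \<noteq> {} \<Longrightarrow> connected A \<Longrightarrow> closed A \<Longrightarrow> \<exists>a\<in>A. \<exists>b\<in>A. a \<noteq> b
      \<Longrightarrow> \<exists>n. diameter (T n ` A) > c"
    by simp_all
  \<comment> \<open>With this value the tolerance \<open>c / 2\<close> of uniform expansiveness is
    the \<open>2 * a\<close> that \<open>shell_control\<close> requires.\<close>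
  define a where "a = c / 4"
  have "a > 0" and c2: "c / 2 = 2 * a" using c(1) by (auto simp: a_def)
  have uniform: "\<exists>M. \<forall>A. A \<subseteq> X \<and> connected A \<and>
    (\<forall>n\<in>icube M. \<forall>p\<in>A. \<forall>q\<in>A. dist (T n p) (T n q) \<le> 2 * a) \<longrightarrow> (\<forall>p\<in>A. \<forall>q\<in>A. dist p q < \<delta>)"
    if "\<delta> > 0" for \<delta>
    using cw_expansive_uniform[OF act c(1) that c(2)] unfolding c2 .
  obtain M0 where M0: "\<forall>A. A \<subseteq> X \<and> connected A \<and>
    (\<forall>n\<in>icube M0. \<forall>p\<in>A. \<forall>q\<in>A. dist (T n p) (T n q) \<le> 2 * a) \<longrightarrow> (\<forall>p\<in>A. \<forall>q\<in>A. dist p q < a)"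
    using uniform[OF \<open>a > 0\<close>] ..
  \<comment> \<open>For \<open>T m u\<close> within \<open>a / 4\<close> of a net point, coordinates
    varying by at most \<open>2 * (a / 8)\<close> put \<open>T m v\<close> within
    \<open>a / 2\<close> of it, so the two points are less than \<open>3 * a / 4\<close>
    apart.\<close>
  obtain Z where Z: "finite Z" "Z \<subseteq> X" "X \<subseteq> (\<Union>z\<in>Z. ball z (a / 4))"
  proof (rule compactE_image[OF \<open>compact X\<close>, of X "\<lambda>z. ball z (a / 4)"])
    show "X \<subseteq> (\<Union>z\<in>X. ball z (a / 4))" using \<open>a > 0\<close> by auto
  qed (simp, rule that)
  define B where "B = 2 * M0 * CARD('n) * card Z"
  show thesis
  proof (rule that[of B])
    fix eps :: real assume "eps > 0"
    then obtain M1 where M1: "\<forall>A. A \<subseteq> X \<and> connected A \<and>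
      (\<forall>n\<in>icube M1. \<forall>p\<in>A. \<forall>q\<in>A. dist (T n p) (T n q) \<le> 2 * a) \<longrightarrow> (\<forall>p\<in>A. \<forall>q\<in>A. dist p q < eps / 2)"
      using uniform[of "eps / 2"] by auto
    define M where "M = max M0 M1"
    have bound: "Widim_eps eps X (dT T \<Omega>) \<le> enat (B * (4 * N + 1) ^ (CARD('n) - 1) + 1)"
      if N: "N \<ge> M" and \<Omega>: "\<Omega> \<subseteq> icube N" "\<Omega> \<noteq> {}" for N \<Omega>
    proof -
      \<comment> \<open>The margin \<open>M\<close> ensures that a time in \<open>\<Omega>\<close>
        plus one in \<open>icube M1\<close> stays in \<open>icube R\<close>, so \<open>M1\<close>
        can be applied to the image of a continuum at each time in \<open>\<Omega>\<close>.\<close>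
      define R where "R = N + M"
      have "M0 \<le> R" by (simp add: R_def M_def)
      define I where "I = (icube R - icube (R - M0) :: (int^'n) set) \<times> Z"
      define g where "g = (\<lambda>(n::int^'n, z) x. dist (T n x) z)"
      have "finite I" unfolding I_def using finite_icube Z(1) by blast
      have "Widim_eps eps X (dT T \<Omega>) \<le> enat (card I + 1)"
      proof (rule Widim_eps_of_connected_small[OF \<open>compact X\<close> cont \<open>finite I\<close>, where g = g and s = "a / 8"])
        show "continuous_on X (g i)" if "i \<in> I" for i
          unfolding g_def using cont by (cases i) (auto intro!: continuous_intros)
        show "a / 8 > 0" using \<open>a > 0\<close> by simp
        show "finite \<Omega>" using \<Omega>(1) finite_icube by (rule finite_subset)
        show "\<Omega> \<noteq> {}" "eps > 0" by fact+
        fix A n p q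
        assume A: "A \<subseteq> X" "connected A" "closed A"
          and gA: "\<And>i u v. i \<in> I \<Longrightarrow> u \<in> A \<Longrightarrow> v \<in> A \<Longrightarrow> \<bar>g i u - g i v\<bar> \<le> 2 * (a / 8)"
          and n: "n \<in> \<Omega>" and pq: "p \<in> A" "q \<in> A"
        have shell: "dist (T m u) (T m v) < a"
          if m: "m \<in> icube R - icube (R - M0)" and uv: "u \<in> A" "v \<in> A" for m u v
        proof -
          have "T m u \<in> X" using TX uv(1) A(1) by blast
          then obtain z where z: "z \<in> Z" "dist z (T m u) < a / 4" using Z(3) by auto
          have "(m, z) \<in> I" using m z(1) by (simp add: I_def)
          from gA[OF this uv] have "\<bar>dist (T m u) z - dist (T m v) z\<bar> \<le> a / 4" by (simp add: g_def)
          then have "dist (T m v) z < a / 2" using z(2) unfolding dist_commute[of z] by linarith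
          then show ?thesis
            using dist_triangle2[of "T m u" "T m v" z] z(2) \<open>a > 0\<close> by (simp add: dist_commute)
        qed
        have inner: "dist (T m u) (T m v) \<le> a" if "m \<in> icube R" "u \<in> A" "v \<in> A" for m u v
        proof (rule shell_control[OF act \<open>a > 0\<close> _ A \<open>M0 \<le> R\<close> shell that])
          fix A' p' q'
          assume "A' \<subseteq> X" "connected A'"
            "\<And>n u v. n \<in> icube M0 \<Longrightarrow> u \<in> A' \<Longrightarrow> v \<in> A' \<Longrightarrow> dist (T n u) (T n v) \<le> 2 * a" "p' \<in> A'" "q' \<in> A'"
          then show "dist p' q' < a" using M0 by blast
        qed
        have imX: "T n ` A \<subseteq> X" using TX A(1) by blast
        have imC: "connected (T n ` A)"
          using A(2) continuous_on_subset[OF cont A(1)] by (rule connected_continuous_image[rotated])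
        have imS: "dist (T m u) (T m v) \<le> 2 * a" if m: "m \<in> icube M1" and im: "u \<in> T n ` A" "v \<in> T n ` A" for m u v
        proof -
          obtain u' v' where uv: "u = T n u'" "v = T n v'" "u' \<in> A" "v' \<in> A" using im by blast
          have "m + n \<in> icube (M1 + N)" using m n \<Omega>(1) by (intro icube_add) auto
          moreover have "icube (M1 + N) \<subseteq> (icube R :: (int^'n) set)" by (rule icube_mono) (simp add: R_def M_def)
          ultimately have "dist (T (m + n) u') (T (m + n) v') \<le> a" using uv by (intro inner) auto
          moreover have "T (m + n) u' = T m u" "T (m + n) v' = T m v" using uv T_add A(1) by auto
          ultimately show ?thesis using \<open>a > 0\<close> by simp
        qed
        have "\<forall>p\<in>T n ` A. \<forall>q\<in>T n ` A. dist p q < eps / 2"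
          using imX imC imS by (intro M1[THEN spec, THEN mp] conjI ballI)
        then show "dist (T n p) (T n q) < eps / 2" using pq by simp
      qed
      also have "card I \<le> B * (4 * N + 1) ^ (CARD('n) - 1)"
      proof -
        have "card I = card (icube R - icube (R - M0) :: (int^'n) set) * card Z"
          by (simp add: I_def card_cartesian_product)
        also have "\<dots> \<le> 2 * M0 * CARD('n) * (2 * R + 1) ^ (CARD('n) - 1) * card Z"
          using card_icube_shell_le[OF \<open>M0 \<le> R\<close>] by (rule mult_right_mono) simp
        also have "\<dots> = B * (2 * R + 1) ^ (CARD('n) - 1)" by (simp only: B_def ac_simps)
        \<comment> \<open>From \<open>N \<ge> M\<close> follows
          \<open>2 * R + 1 \<le> 4 * N + 1\<close>.\<close>
        also have "\<dots> \<le> B * (4 * N + 1) ^ (CARD('n) - 1)"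
          using N by (intro mult_left_mono power_mono) (auto simp: R_def)
        finally show ?thesis .
      qed
      finally show ?thesis by simp
    qed
    then show "\<exists>M. \<forall>N\<ge>M. \<forall>\<Omega>. \<Omega> \<subseteq> icube N \<and> \<Omega> \<noteq> {} \<longrightarrow>
     Widim_eps eps X (dT T \<Omega>) \<le> enat (B * (4 * N + 1) ^ (CARD('n) - 1) + 1)" by blast
  qed
qed

theorem theorem1p2:
  fixes X :: "'a::metric_space set" and T :: "int^'n \<Rightarrow> 'a \<Rightarrow> 'a"
  assumes "Zk_action X T" and "cw_expansive X T"
  shows "\<exists>C::real. C \<ge> 0 \<and>
           (\<forall>r. r > sqrt (real CARD('n)) / 2 \<longrightarrow>
              (\<forall>v::real^'n. v \<noteq> 0 \<longrightarrow> mdim X T r (orth_compl v) \<le> ereal C))"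
proof -
  define h where "h = CARD('n) - 1"
  obtain B :: nat where B: "\<And>eps. eps > 0 \<Longrightarrow> \<exists>M. \<forall>N\<ge>M. \<forall>\<Omega>. \<Omega> \<subseteq> icube N \<and> \<Omega> \<noteq> {} \<longrightarrow>
     Widim_eps eps X (dT T \<Omega>) \<le> enat (B * (4 * N + 1) ^ h + 1)"
    using cw_expansive_Widim_bound[OF assms] unfolding h_def by blast
  \<comment> \<open>For \<open>N \<ge> 1\<close>, \<open>4 * N + 1 \<le> 5 * N\<close> and
    \<open>1 \<le> N ^ h\<close> bound the width by \<open>(B * 5 ^ h + 1) * N ^ h\<close>. The last
    factor comes from the lower bound \<open>(N / CARD('n)) ^ h\<close> for the volume.\<close>
  define C where "C = (real B * 5 ^ h + 1) * real CARD('n) ^ h"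
  have "mdim X T r (orth_compl v) \<le> ereal C"
    if r: "r > sqrt (real CARD('n)) / 2" and v: "v \<noteq> 0" for r and v :: "real^'n"
  proof -
    define V where "V = orth_compl v"
    have "subspace V" unfolding V_def orth_compl_def by (rule subspace_hyperplane)
    have dimV: "dim V = h" unfolding V_def orth_compl_def h_def using dim_hyperplane[OF v] by simp
    have "r > 0" using r by (rule le_less_trans[rotated]) simp
    \<comment> \<open>The origin makes every set of times \<open>Bset r V \<inter> icube N\<close>
      nonempty, as the width bound demands.\<close>
    have "0 \<in> Bset r V"
      using \<open>r > 0\<close> subspace_0[OF \<open>subspace V\<close>]
      by (auto simp: Bset_def real_of_intvec_def zero_vec_def[symmetric] intro!: bexI[of _ 0])
    define f where "f = (\<lambda>eps N. ereal_of_enat (Widim_eps eps X (dT T (Bset r V \<inter> icube N)))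
                   / ereal (vol_sub V (V \<inter> rcube N)))"
    \<comment> \<open>The volume does not depend on \<open>eps\<close>, so monotonicity of the width
      survives division by it; this gives the convergence behind \<open>Lim\<close>.\<close>
    have anti: "liminf (f y) \<le> liminf (f x)" if "x \<le> y" for x y
    proof (intro Liminf_mono always_eventually allI)
      fix N
      have "vol_sub V (V \<inter> rcube N) \<ge> 0" by (simp add: vol_sub_def)
      then have "inverse (ereal (vol_sub V (V \<inter> rcube N))) \<ge> 0" by (simp add: inverse_ereal_ge0I)
      then show "f y N \<le> f x N"
        unfolding f_def divide_ereal_def using Widim_eps_antimono[OF that]
        by (intro ereal_mult_right_mono) simp_all
    qed
    have le: "liminf (f eps) \<le> ereal C" if eps: "eps > 0" for eps
    proof -
      obtain M where M: "\<forall>N\<ge>M. \<forall>\<Omega>. \<Omega> \<subseteq> icube N \<and> \<Omega> \<noteq> {} \<longrightarrow>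
          Widim_eps eps X (dT T \<Omega>) \<le> enat (B * (4 * N + 1) ^ h + 1)"
        using B[OF eps] ..
      have fle: "f eps N \<le> ereal C" if N: "N \<ge> max M 1" for N
      proof -
        let ?vol = "vol_sub V (V \<inter> rcube N)"
        have "Bset r V \<inter> icube N \<noteq> {}" using \<open>0 \<in> Bset r V\<close> zero_in_icube by blast
        then have "Widim_eps eps X (dT T (Bset r V \<inter> icube N)) \<le> enat (B * (4 * N + 1) ^ h + 1)"
          using M N by auto
        then have w: "ereal_of_enat (Widim_eps eps X (dT T (Bset r V \<inter> icube N))) \<le> ereal (real (B * (4 * N + 1) ^ h + 1))"
          by (metis ereal_of_enat_le_iff ereal_of_enat_simps(1))
        have "real N \<ge> 1" using N by simp
        have "?vol \<ge> (2 * real N / real CARD('n)) ^ h"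
          using vol_sub_cube_ge[OF \<open>subspace V\<close>, of N] dimV by simp
        moreover have "(2 * real N / real CARD('n)) ^ h \<ge> (real N / real CARD('n)) ^ h"
          using \<open>real N \<ge> 1\<close> by (intro power_mono divide_right_mono) auto
        ultimately have vol: "?vol \<ge> (real N / real CARD('n)) ^ h" by linarith
        moreover have "(real N / real CARD('n)) ^ h > 0" using \<open>real N \<ge> 1\<close> by simp
        ultimately have "?vol > 0" by linarith
        have "real (B * (4 * N + 1) ^ h + 1) \<le> (real B * 5 ^ h + 1) * real N ^ h"
        proof -
          have "real ((4 * N + 1) ^ h) \<le> (5 * real N) ^ h"
            using \<open>real N \<ge> 1\<close> unfolding of_nat_power by (intro power_mono) auto
          then have "real B * real ((4 * N + 1) ^ h) \<le> real B * (5 ^ h * real N ^ h)"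
            unfolding power_mult_distrib by (intro mult_left_mono) auto
          moreover have "1 \<le> real N ^ h" using \<open>real N \<ge> 1\<close> by (rule one_le_power)
          ultimately show ?thesis by (simp add: algebra_simps)
        qed
        also have "\<dots> = C * (real N / real CARD('n)) ^ h" by (simp add: C_def power_divide)
        also have "\<dots> \<le> C * ?vol" using vol by (intro mult_left_mono) (auto simp: C_def)
        finally have "ereal (real (B * (4 * N + 1) ^ h + 1)) \<le> ereal ?vol * ereal C"
          by (simp add: mult.commute del: of_nat_add of_nat_mult of_nat_power)
        with w have "ereal_of_enat (Widim_eps eps X (dT T (Bset r V \<inter> icube N))) \<le> ereal ?vol * ereal C"
          by (rule order_trans)
        then show ?thesis unfolding f_def using \<open>?vol > 0\<close> by (subst ereal_divide_le_pos) auto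
      qed
      have "liminf (f eps) \<le> liminf (\<lambda>N. ereal C)"
        using eventually_sequentiallyI[where c = "max M 1", OF fle] by (rule Liminf_mono)
      then show ?thesis by (simp add: Liminf_const)
    qed
    have "mdim X T r V = Lim (at_right 0) (\<lambda>eps. liminf (f eps))"
      unfolding mdim_def f_def ..
    also have "\<dots> \<le> ereal C" using anti le by (intro Lim_at_right_antimono_le)
    finally show ?thesis by (simp add: V_def)
  qed
  moreover have "C \<ge> 0" by (simp add: C_def)
  ultimately show ?thesis by blast
qed

end
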